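(* Let $\mathfrak{L}$ be the generalized super $W$-algebra described in the context and let $\mathfrak{V}=\mathfrak{L}\otimes\mathfrak{L}$ with the adjoint diagonal action. Then $H^1(\mathfrak{L},\mathfrak{V})=0$. Equivalently, $\mathrm{Der}(\mathfrak{L},\mathfrak{V})=\mathrm{Inn}(\mathfrak{L},\mathfrak{V})$: every derivation from $\mathfrak{L}$ to $\mathfrak{V}$ is inner. This holds in both cases $s\in\Gamma$ and $s\notin\Gamma$ (with $2s\in\Gamma$).
   Context: Let $\Gamma$ be a nontrivial additive subgroup of $\mathbb{R}$, and let $s\in\mathbb{R}$ with $2s\in\Gamma$. The Lie superalgebra $\mathfrak{L}$ over $\mathbb{C}$ has basis $\{L_p,I_p,G_r,H_r\mid p\in\Gamma,\ r\in s+\Gamma\}$. Here $L_p,I_p$ are even and $G_r,H_r$ are odd. The nonzero super-brackets are $[L_p,L_q]=(p-q)L_{p+q}$, $[L_p,I_q]=(p-q)I_{p+q}$, $[L_p,G_r]=(\tfrac p2-r)G_{p+r}$, $[L_p,H_r]=(\tfrac p2-r)H_{p+r}$, $[G_r,G_t]=I_{r+t}$, $[I_p,G_r]=(p-2r)H_{p+r}$. All other brackets of basis elements vanish, apart from those forced by super-antisymmetry. For a homogeneous element $x$, $[x]\in\mathbb{Z}_2$ denotes its parity. Let $\mathfrak{V}=\mathfrak{L}\otimes\mathfrak{L}$ be the algebraic tensor product, with parity $[a\otimes b]=[a]+[b]$. $\mathfrak{L}$ acts on $\mathfrak{V}$ by the adjoint diagonal action $x\circ(a\otimes b)=[x,a]\otimes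 b+(-1)^{[x][a]}a\otimes[x,b]$. A linear map $d:\mathfrak{L}\to\mathfrak{V}$ is a homogeneous derivation of parity $[d]\in\mathbb{Z}_2$ if it shifts parity by $[d]$ and satisfies $d([x,y])=(-1)^{[d][x]}x\circ d(y)-(-1)^{[y]([d]+[x])}y\circ d(x)$ for all homogeneous $x,y$. $\mathrm{Der}(\mathfrak{L},\mathfrak{V})$ is the direct sum of the even and odd derivations. For homogeneous $a\in\mathfrak{V}$, the inner derivation $a_{\mathrm{Inn}}$ is $a_{\mathrm{Inn}}(x)=(-1)^{[a][x]}x\circ a$; this is extended linearly in $a$. $\mathrm{Inn}(\mathfrak{L},\mathfrak{V})$ is the space of all such maps, and $H^1(\mathfrak{L},\mathfrak{V})=\mathrm{Der}(\mathfrak{L},\mathfrak{V})/\mathrm{Inn}(\mathfrak{L},\mathfrak{V})$. *)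

theory Defs
  imports Complex_Main
begin

text \<open>Basis of the generalized super W-algebra: L_p, I_p (even), G_r, H_r (odd).
  Elements of the algebra are finitely supported coefficient functions on the basis;
  elements of the tensor square are finitely supported functions on pairs of basis elements.\<close>

datatype B = L real | I real | G real | H real

fun par :: "B \<Rightarrow> bool" where
  "par (L _) = False" | "par (I _) = False" | "par (G _) = True" | "par (H _) = True"

fun valid :: "real set \<Rightarrow> real \<Rightarrow> B \<Rightarrow> bool" where
  "valid \<Gamma> s (L p) = (p \<in> \<Gamma>)"
| "valid \<Gamma> s (I p) = (p \<in> \<Gamma>)"
| "valid \<Gamma> s (G r) = (r - s \<in> \<Gamma>)"
| "valid \<Gamma> s (H r) = (r - s \<in> \<Gamma>)"

definition vec :: "B \<Rightarrow> complex \<Rightarrow> B \<Rightarrow> complex" where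
  "vec b c = (\<lambda>x. if x = b then c else 0)"

text \<open>Bracket of basis elements, including the ones forced by super-antisymmetry.\<close>
fun br :: "B \<Rightarrow> B \<Rightarrow> B \<Rightarrow> complex" where
  "br (L p) (L q) = vec (L (p + q)) (of_real (p - q))"
| "br (L p) (I q) = vec (I (p + q)) (of_real (p - q))"
| "br (I q) (L p) = vec (I (p + q)) (- of_real (p - q))"
| "br (L p) (G r) = vec (G (p + r)) (of_real (p / 2 - r))"
| "br (G r) (L p) = vec (G (p + r)) (- of_real (p / 2 - r))"
| "br (L p) (H r) = vec (H (p + r)) (of_real (p / 2 - r))"
| "br (H r) (L p) = vec (H (p + r)) (- of_real (p / 2 - r))"
| "br (G r) (G t) = vec (I (r + t)) 1"
| "br (I p) (G r) = vec (H (p + r)) (of_real (p - 2 * r))"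
| "br (G r) (I p) = vec (H (p + r)) (- of_real (p - 2 * r))"
| "br _ _ = (\<lambda>_. 0)"

definition supp :: "('a \<Rightarrow> complex) \<Rightarrow> 'a set" where
  "supp f = {b. f b \<noteq> 0}"

definition Lcar :: "real set \<Rightarrow> real \<Rightarrow> (B \<Rightarrow> complex) set" where
  "Lcar \<Gamma> s = {x. finite (supp x) \<and> (\<forall>b\<in>supp x. valid \<Gamma> s b)}"

definition Vcar :: "real set \<Rightarrow> real \<Rightarrow> (B \<times> B \<Rightarrow> complex) set" where
  "Vcar \<Gamma> s = {v. finite (supp v) \<and> (\<forall>t\<in>supp v. valid \<Gamma> s (fst t) \<and> valid \<Gamma> s (snd t))}"

definition brk :: "(B \<Rightarrow> complex) \<Rightarrow> (B \<Rightarrow> complex) \<Rightarrow> B \<Rightarrow> complex" where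
  "brk x y = (\<lambda>b. \<Sum>c\<in>supp x. \<Sum>d\<in>supp y. x c * y d * br c d b)"

definition tens :: "(B \<Rightarrow> complex) \<Rightarrow> (B \<Rightarrow> complex) \<Rightarrow> B \<times> B \<Rightarrow> complex" where
  "tens u w = (\<lambda>t. u (fst t) * w (snd t))"

definition sg :: "bool \<Rightarrow> complex" where
  "sg q = (if q then -1 else 1)"

definition actb :: "B \<Rightarrow> B \<times> B \<Rightarrow> B \<times> B \<Rightarrow> complex" where
  "actb e t = (\<lambda>k. tens (br e (fst t)) (vec (snd t) 1) k
                 + sg (par e \<and> par (fst t)) * tens (vec (fst t) 1) (br e (snd t)) k)"

definition act :: "(B \<Rightarrow> complex) \<Rightarrow> (B \<times> B \<Rightarrow> complex) \<Rightarrow> B \<times> B \<Rightarrow> complex" where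
  "act x v = (\<lambda>k. \<Sum>e\<in>supp x. \<Sum>t\<in>supp v. x e * v t * actb e t k)"

definition homL :: "real set \<Rightarrow> real \<Rightarrow> bool \<Rightarrow> (B \<Rightarrow> complex) \<Rightarrow> bool" where
  "homL \<Gamma> s q x \<longleftrightarrow> x \<in> Lcar \<Gamma> s \<and> (\<forall>b\<in>supp x. par b = q)"

definition homV :: "real set \<Rightarrow> real \<Rightarrow> bool \<Rightarrow> (B \<times> B \<Rightarrow> complex) \<Rightarrow> bool" where
  "homV \<Gamma> s q v \<longleftrightarrow> v \<in> Vcar \<Gamma> s \<and> (\<forall>t\<in>supp v. (par (fst t) \<noteq> par (snd t)) = q)"

definition evp :: "(B \<Rightarrow> complex) \<Rightarrow> B \<Rightarrow> complex" where
  "evp x = (\<lambda>b. if par b then 0 else x b)"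

definition odp :: "(B \<Rightarrow> complex) \<Rightarrow> B \<Rightarrow> complex" where
  "odp x = (\<lambda>b. if par b then x b else 0)"

definition is_der :: "real set \<Rightarrow> real \<Rightarrow> bool \<Rightarrow> ((B \<Rightarrow> complex) \<Rightarrow> (B \<times> B \<Rightarrow> complex)) \<Rightarrow> bool" where
  "is_der \<Gamma> s p d \<longleftrightarrow>
     (\<forall>x\<in>Lcar \<Gamma> s. d x \<in> Vcar \<Gamma> s)
   \<and> (\<forall>x\<in>Lcar \<Gamma> s. \<forall>y\<in>Lcar \<Gamma> s. d (\<lambda>b. x b + y b) = (\<lambda>k. d x k + d y k))
   \<and> (\<forall>c. \<forall>x\<in>Lcar \<Gamma> s. d (\<lambda>b. c * x b) = (\<lambda>k. c * d x k))
   \<and> (\<forall>q x. homL \<Gamma> s q x \<longrightarrow> homV \<Gamma> s (q \<noteq> p) (d x))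
   \<and> (\<forall>qx qy x y. homL \<Gamma> s qx x \<longrightarrow> homL \<Gamma> s qy y \<longrightarrow>
        d (brk x y) = (\<lambda>k. sg (p \<and> qx) * act x (d y) k
                           - sg (qy \<and> (p \<noteq> qx)) * act y (d x) k))"

definition Der :: "real set \<Rightarrow> real \<Rightarrow> ((B \<Rightarrow> complex) \<Rightarrow> (B \<times> B \<Rightarrow> complex)) \<Rightarrow> bool" where
  "Der \<Gamma> s d \<longleftrightarrow> (\<exists>d0 d1. is_der \<Gamma> s False d0 \<and> is_der \<Gamma> s True d1
       \<and> (\<forall>x\<in>Lcar \<Gamma> s. d x = (\<lambda>k. d0 x k + d1 x k)))"

text \<open>Inner derivation a_Inn for homogeneous a of parity pa:
  a_Inn(x) = (-1)^([a][x]) x \<circ> a, extended linearly in x.\<close>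
definition inn :: "bool \<Rightarrow> (B \<times> B \<Rightarrow> complex) \<Rightarrow> (B \<Rightarrow> complex) \<Rightarrow> B \<times> B \<Rightarrow> complex" where
  "inn pa a x = (\<lambda>k. act (evp x) a k + sg pa * act (odp x) a k)"

text \<open>Inn = span of inner derivations = sums a0_Inn + a1_Inn with a0 even, a1 odd.\<close>
definition Inn :: "real set \<Rightarrow> real \<Rightarrow> ((B \<Rightarrow> complex) \<Rightarrow> (B \<times> B \<Rightarrow> complex)) \<Rightarrow> bool" where
  "Inn \<Gamma> s d \<longleftrightarrow> (\<exists>a0 a1. homV \<Gamma> s False a0 \<and> homV \<Gamma> s True a1
       \<and> (\<forall>x\<in>Lcar \<Gamma> s. d x = (\<lambda>k. inn False a0 x k + inn True a1 x k)))"

end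

theory Submission
  imports Defs
begin

text \<open>
  Every basis vector \<open>b\<close> satisfies \<open>[L p, b] = (\<alpha> * p - x) b'\<close>, where \<open>x\<close> is the grade of \<open>b\<close>, the
  density \<open>\<alpha>\<close> is 1 or 1/2, and \<open>b'\<close> is \<open>b\<close> moved by \<open>p\<close>. Fix \<open>g > 0\<close> in the index group and follow
  a derivation \<open>D\<close> along a column, the coefficients of \<open>D (L (n * g))\<close> at \<open>b\<close> moved by \<open>n * g\<close>,
  tensored with a fixed \<open>c\<close>. If \<open>D\<close> is given by the action on a finitely supported \<open>v\<close>, then for
  large \<open>n\<close> only the term that moves \<open>b\<close> survives, and the column is
  \<open>(\<alpha> * n * g - x) * v (b, c)\<close>. Conversely, for large indices the derivation rule makes the column
  of any \<open>D\<close> a cocycle in a density module, and such a cocycle is eventually of this form: on the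
  multiples of each large \<open>n\<close> it is a cocycle for all positive indices, which is determined by its
  first value, and common multiples compare the constants for different \<open>n\<close>. This defines \<open>v\<close>.
  The columns of the difference between \<open>D\<close> and the action on \<open>v\<close> are eventually zero, and the
  derivation rule with one large index then makes it vanish on all \<open>L (n * g)\<close>. That \<open>v\<close> has finite
  support follows from the action of \<open>L 0\<close> and by comparing two steps of length \<open>p\<close> with one step of
  length \<open>2 * p\<close>.

  Once \<open>D\<close> vanishes on all \<open>L (n * g)\<close>, it commutes with these elements, and acting on \<open>D e\<close> by
  \<open>L (2 * p)\<close> after \<open>L p\<close> or by \<open>L (3 * p)\<close> produces, for large \<open>p\<close>, tensors of different support
  that have to be proportional, so \<open>D e = 0\<close>.
\<close>

section \<open>Cocycles in a density module\<close>

text \<open>In the module with \<open>[L m, X y] = (a * m - y) X (m + y)\<close> this is the cocycle rule for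
  \<open>L n \<mapsto> h n X (n - x)\<close>, restricted to indices \<open>n \<ge> N\<close>.\<close>
definition density_cocycle :: "real \<Rightarrow> real \<Rightarrow> int \<Rightarrow> (int \<Rightarrow> complex) \<Rightarrow> bool" where
  "density_cocycle a x N h \<longleftrightarrow> (\<forall>m\<ge>N. \<forall>n\<ge>N. of_int (m - n) * h (m + n) =
     of_real (a * of_int m - of_int n + x) * h n - of_real (a * of_int n - of_int m + x) * h m)"

lemma density_cocycleD:
  assumes "density_cocycle a x N h" "m \<ge> N" "n \<ge> N"
  shows "of_int (m - n) * h (m + n) =
    of_real (a * of_int m - of_int n + x) * h n - of_real (a * of_int n - of_int m + x) * h m"
  using assms unfolding density_cocycle_def by blast

lemma density_cocycle_principal: "density_cocycle a x N (\<lambda>n. c * of_real (a * of_int n + x))"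
  unfolding density_cocycle_def by (simp add: algebra_simps)

lemma density_cocycle_diff:
  assumes "density_cocycle a x N h" "density_cocycle a x N h'"
  shows "density_cocycle a x N (\<lambda>n. h n - h' n)"
  unfolding density_cocycle_def
proof (intro allI impI)
  fix m n :: int
  assume "N \<le> m" "N \<le> n"
  with assms[THEN density_cocycleD]
  show "of_int (m - n) * (h (m + n) - h' (m + n)) =
      of_real (a * of_int m - of_int n + x) * (h n - h' n)
    - of_real (a * of_int n - of_int m + x) * (h m - h' m)"
    by (simp add: right_diff_distrib del: of_int_diff of_real_add of_real_diff)
qed

lemma density_cocycle_multiples:
  assumes "density_cocycle a x N h" "P \<ge> N" "P > 0"
  shows "density_cocycle a (x / of_int P) 1 (\<lambda>n. h (n * P))"
  unfolding density_cocycle_def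
proof (intro allI impI)
  fix m n :: int
  assume "1 \<le> m" "1 \<le> n"
  then have "m * P \<ge> N" "n * P \<ge> N"
    using assms(2,3) mult_right_mono[of 1 m P] mult_right_mono[of 1 n P] by linarith+
  from density_cocycleD[OF assms(1) this]
  have "of_int P * (of_int (m - n) * h ((m + n) * P)) =
      of_real (a * of_int (m * P) - of_int (n * P) + x) * h (n * P)
    - of_real (a * of_int (n * P) - of_int (m * P) + x) * h (m * P)"
    by (simp add: algebra_simps)
  moreover have "a * of_int (i * P) - of_int (j * P) + x
      = of_int P * (a * of_int i - of_int j + x / of_int P)" for i j
    using \<open>P > 0\<close> by (simp add: field_simps)
  ultimately have "of_int P * (of_int (m - n) * h ((m + n) * P)) =
      of_int P * (of_real (a * of_int m - of_int n + x / of_int P) * h (n * P)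
    - of_real (a * of_int n - of_int m + x / of_int P) * h (m * P))"
    by (simp only: of_real_mult of_real_of_int_eq mult.assoc right_diff_distrib)
  then show "of_int (m - n) * h ((m + n) * P) =
      of_real (a * of_int m - of_int n + x / of_int P) * h (n * P)
    - of_real (a * of_int n - of_int m + x / of_int P) * h (m * P)"
    using \<open>P > 0\<close> by simp
qed

lemma density_cocycle_recursion:
  assumes "density_cocycle a x 1 h" and "h 1 = 0" and "n \<ge> 1"
  shows "of_int (n - 1) * h (n + 1) = (of_int n - of_real (a + x)) * h n"
  using density_cocycleD[OF assms(1) assms(3), of 1] assms(2) by (simp add: algebra_simps)

lemma density_cocycle_at_2:
  assumes coc: "density_cocycle a x 1 h" and x: "\<bar>x\<bar> < a" and "h 1 = 0"
  shows "h 2 = 0"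
proof -
  define z where "z = complex_of_real (a + x)"
  have "h 3 = (2 - z) * h 2" "2 * h 4 = (3 - z) * h 3" "3 * h 5 = (4 - z) * h 4"
    using density_cocycle_recursion[OF coc \<open>h 1 = 0\<close>, of 2]
      density_cocycle_recursion[OF coc \<open>h 1 = 0\<close>, of 3]
      density_cocycle_recursion[OF coc \<open>h 1 = 0\<close>, of 4] by (simp_all add: z_def)
  moreover have "h 5 = (2 * of_real a - 2 + z) * h 2 - (of_real a - 3 + z) * h 3"
    using density_cocycleD[OF coc, of 3 2] by (simp add: z_def algebra_simps)
  \<comment> \<open>\<open>h 5\<close> has been computed from \<open>[L 4, L 1]\<close> and from \<open>[L 3, L 2]\<close>.\<close>
  ultimately have "z * ((z - 1) * (z - 2) + 6 * of_real a) * h 2 = 0"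
    by algebra
  then have "of_real ((a + x) * ((a + x - 1) * (a + x - 2) + 6 * a)) * h 2 = 0"
    by (simp add: z_def)
  moreover have "(a + x) * ((a + x - 1) * (a + x - 2) + 6 * a) > 0"
  proof -
    have "(a + x - 1) * (a + x - 2) + 6 * a = (a + x)\<^sup>2 + 3 * (a - x) + 2"
      by (simp add: power2_eq_square algebra_simps)
    moreover have "(a + x)\<^sup>2 + 3 * (a - x) + 2 > 0"
      using x by (intro add_nonneg_pos add_nonneg_nonneg) auto
    ultimately show ?thesis
      using x by (intro mult_pos_pos) auto
  qed
  ultimately show ?thesis
    by (metis mult_eq_0_iff of_real_eq_0_iff less_irrefl)
qed

lemma density_cocycle_eq_0:
  assumes coc: "density_cocycle a x 1 h" and x: "\<bar>x\<bar> < a" and "h 1 = 0" and "n \<ge> 1"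
  shows "h n = 0"
proof -
  have "h n = 0" if "n \<ge> 2" for n
    using that
  proof (induction n rule: int_ge_induct)
    case base
    show ?case
      using density_cocycle_at_2[OF coc x \<open>h 1 = 0\<close>] .
  next
    case (step n)
    then have "of_int (n - 1) * h (n + 1) = 0"
      using density_cocycle_recursion[OF coc \<open>h 1 = 0\<close>, of n] by simp
    with step.hyps show ?case
      by (simp only: mult_eq_0_iff of_int_eq_0_iff) auto
  qed
  with \<open>h 1 = 0\<close> \<open>n \<ge> 1\<close> show ?thesis
    by (cases "n = 1") auto
qed

lemma density_cocycle_principal_on_multiples:
  assumes coc: "density_cocycle a x N h"
    and P: "P \<ge> N" "P > 0" "\<bar>x\<bar> < a * of_int P" and "n \<ge> 1"
  shows "h (n * P) = h P / of_real (a * of_int P + x) * of_real (a * of_int (n * P) + x)"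
proof -
  define x' where "x' = x / of_int P"
  define c where "c = h P / of_real (a * of_int P + x)"
  have nonzero: "of_real (a * of_int P + x) \<noteq> (0::complex)"
    using P(3) by (simp only: of_real_eq_0_iff)
  have scale: "c * of_real (a * of_int (i * P) + x)
      = c * of_int P * of_real (a * of_int i + x')" for i
    using P(2) unfolding x'_def by (simp add: field_simps)
  define h' where "h' n = h (n * P) - c * of_int P * of_real (a * of_int n + x')" for n
  have "density_cocycle a x' 1 h'"
    unfolding h'_def x'_def using coc P
    by (intro density_cocycle_diff density_cocycle_multiples density_cocycle_principal)
  moreover have "\<bar>x'\<bar> < a"
    using P(2,3) unfolding x'_def by (simp add: abs_divide field_simps)
  moreover have "h' 1 = 0"
    using nonzero scale[of 1] unfolding h'_def c_def by simp
  ultimately have "h' n = 0"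
    using density_cocycle_eq_0 \<open>n \<ge> 1\<close> by blast
  then have "h (n * P) = c * of_real (a * of_int (n * P) + x)"
    unfolding h'_def scale by simp
  then show ?thesis
    unfolding c_def .
qed

lemma density_cocycle_eventually_principal:
  assumes coc: "density_cocycle a x N h" and "a > 0"
  shows "\<exists>c. \<forall>\<^sub>F n in at_top. h n = c * of_real (a * of_int n + x)"
proof -
  define M where "M = max N (\<lfloor>\<bar>x\<bar> / a\<rfloor> + 1)"
  have M: "P \<ge> N" "P > 0" "\<bar>x\<bar> < a * of_int P" if "P \<ge> M" for P
  proof -
    have "\<bar>x\<bar> / a < of_int P" "\<bar>x\<bar> / a \<ge> 0"
      using that \<open>a > 0\<close> unfolding M_def by (linarith, simp)
    then show "P > 0" "\<bar>x\<bar> < a * of_int P"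
      using \<open>a > 0\<close> by (linarith, simp add: field_simps)
  qed (use that M_def in simp)
  define c where "c P = h P / of_real (a * of_int P + x)" for P
  have nonzero: "of_real (a * of_int P + x) \<noteq> (0::complex)" if "P \<ge> M" for P
    using M(3)[OF that] by (simp only: of_real_eq_0_iff)
  have multiple: "h (n * P) = c P * of_real (a * of_int (n * P) + x)" if "P \<ge> M" "n \<ge> 1" for P n
    unfolding c_def using density_cocycle_principal_on_multiples[OF coc M[OF that(1)] that(2)] .
  have "h n = c M * of_real (a * of_int n + x)" if "n \<ge> M" for n
  proof -
    have "M > 0" "n > 0" "n * M \<ge> M"
      using M(2)[of M] M(2)[OF that] by simp_all
    have "c n * of_real (a * of_int (n * M) + x) = h (n * M)"
      using multiple[OF that, of M] \<open>M > 0\<close> by (simp only: mult.commute[of M])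
    also have "\<dots> = c M * of_real (a * of_int (n * M) + x)"
      using multiple[of M n] \<open>n > 0\<close> by simp
    finally have "c n = c M"
      using nonzero[OF \<open>n * M \<ge> M\<close>] by (simp only: mult_cancel_right) simp
    then show ?thesis
      using multiple[OF that, of 1] by simp
  qed
  then show ?thesis
    unfolding eventually_at_top_linorder by blast
qed

section \<open>The tensor square as a module\<close>

lemma sg_simps [simp]: "sg False = 1" "sg True = -1"
  by (simp_all add: sg_def)

lemma supp_vec_subset: "supp (vec b c) \<subseteq> {b}"
  by (auto simp: supp_def vec_def)

lemma finite_supp_vec: "finite (supp (vec b c))"
  using supp_vec_subset finite_subset by blast

lemma sum_supp_superset:
  assumes "finite T" "supp x \<subseteq> T"
  shows "(\<Sum>e\<in>supp x. x e * F e) = (\<Sum>e\<in>T. x e * (F e :: complex))"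
  using assms by (intro sum.mono_neutral_left) (auto simp: supp_def)

lemma sum_supp_vec: "(\<Sum>x\<in>supp (vec g c). vec g c x * F x) = c * F g"
  using sum_supp_superset[OF _ supp_vec_subset, of g c F] by (simp add: vec_def)

lemma br_eq_vec: "\<exists>c g. br e f = vec g c"
proof -
  have "(\<lambda>_. 0) = vec e 0"
    by (auto simp: vec_def)
  then show ?thesis
    by (cases e; cases f) (simp_all, blast+)
qed

lemma finite_supp_br: "finite (supp (br e f))"
  using br_eq_vec[of e f] finite_supp_vec by metis

lemma br_par: "br e f g \<noteq> 0 \<Longrightarrow> par g = (par e \<noteq> par f)"
  by (cases e; cases f) (auto simp: vec_def split: if_splits)

text \<open>\<open>ad e y\<close> is \<open>[e, y]\<close> in coordinates: every basis element \<open>b\<close> occurs in \<open>[e, d]\<close> for at most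
  one \<open>d\<close>, so the formula makes sense for \<open>y\<close> of infinite support.\<close>
fun ad :: "B \<Rightarrow> (B \<Rightarrow> complex) \<Rightarrow> B \<Rightarrow> complex" where
  "ad (L p) y (L q) = of_real (p - (q - p)) * y (L (q - p))"
| "ad (L p) y (I q) = of_real (p - (q - p)) * y (I (q - p))"
| "ad (L p) y (G q) = of_real (p / 2 - (q - p)) * y (G (q - p))"
| "ad (L p) y (H q) = of_real (p / 2 - (q - p)) * y (H (q - p))"
| "ad (I p) y (I q) = of_real (p - (q - p)) * y (L (q - p))"
| "ad (I p) y (H q) = of_real (p - 2 * (q - p)) * y (G (q - p))"
| "ad (G p) y (G q) = of_real (p - (q - p) / 2) * y (L (q - p))"
| "ad (G p) y (I q) = 1 * y (G (q - p))"
| "ad (G p) y (H q) = of_real (2 * p - (q - p)) * y (I (q - p))"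
| "ad (H p) y (H q) = of_real (p - (q - p) / 2) * y (L (q - p))"
| "ad _ _ _ = 0"

lemma br_eq_ad: "br e d b = ad e (vec d 1) b"
  by (cases e; cases d; cases b) (auto simp: vec_def)

lemma ad_monomial:
  obtains c d where "\<And>y. ad e y b = c * y d" "c \<noteq> 0 \<Longrightarrow> par d = (par b \<noteq> par e)"
proof -
  have "\<exists>c d. (\<forall>y. ad e y b = c * y d) \<and> (c \<noteq> 0 \<longrightarrow> par d = (par b \<noteq> par e))"
  proof -
    have monomial: ?thesis if "\<And>y. ad e y b = c * y d" "par d = (par b \<noteq> par e)" for c d
      using that by blast
    have zero: ?thesis if "\<And>y. ad e y b = 0"
      using that by (intro exI[of _ 0]) simp
    show ?thesis
      by (cases e; cases b)
        ((rule zero, simp; fail) | (rule monomial, simp only: ad.simps, simp))+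
  qed
  with that show ?thesis
    by blast
qed

lemma ad_add: "ad e (\<lambda>x. y x + z x) b = ad e y b + ad e z b"
  by (rule ad_monomial[of e b]) (simp add: distrib_left)

lemma ad_scale: "ad e (\<lambda>x. c * y x) b = c * ad e y b"
  by (rule ad_monomial[of e b]) simp

lemma ad_sum: "ad e (\<lambda>x. \<Sum>t\<in>T. f t x) b = (\<Sum>t\<in>T. ad e (f t) b)"
  by (rule ad_monomial[of e b]) (simp add: sum_distrib_left)

lemma ad_sg: "ad e (\<lambda>x. sg (q \<and> par x) * y x) b = sg (q \<and> (par b \<noteq> par e)) * ad e y b"
proof (rule ad_monomial[of e b])
  fix c d
  assume "\<And>y. ad e y b = c * y d" "c \<noteq> 0 \<Longrightarrow> par d = (par b \<noteq> par e)"
  then show ?thesis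
    by (cases "c = 0") simp_all
qed

lemma ad_commute: "ad e (\<lambda>x. ad f (\<lambda>z. v (x, z)) b') b = ad f (\<lambda>z. ad e (\<lambda>x. v (x, z)) b) b'"
  by (rule ad_monomial[of e b], rule ad_monomial[of f b']) simp

lemma ad_br: "(\<Sum>g\<in>supp (br e f). br e f g * ad g y b)
    = ad e (ad f y) b - sg (par e \<and> par f) * ad f (ad e y) b"
proof -
  have [simp]: "supp (\<lambda>_. 0) = {}"
    by (simp add: supp_def)
  have [simp]: "q - p - r = q - (p + r)" for p q r :: real
    by simp
  show ?thesis
    by (cases e; cases f; cases b)
       (simp_all add: sum_supp_vec, simp_all add: add.commute field_simps)
qed

definition ad_tensor :: "B \<Rightarrow> (B \<times> B \<Rightarrow> complex) \<Rightarrow> B \<times> B \<Rightarrow> complex" where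
  "ad_tensor e v k = ad e (\<lambda>x. v (x, snd k)) (fst k)
     + sg (par e \<and> par (fst k)) * ad e (\<lambda>x. v (fst k, x)) (snd k)"

lemma ad_tensor_add: "ad_tensor e (\<lambda>k. v k + w k) k = ad_tensor e v k + ad_tensor e w k"
  by (simp add: ad_tensor_def ad_add distrib_left)

lemma ad_tensor_scale: "ad_tensor e (\<lambda>k. c * v k) k = c * ad_tensor e v k"
  by (simp add: ad_tensor_def ad_scale distrib_left)

lemma ad_tensor_zero: "ad_tensor e (\<lambda>_. 0) k = 0"
  using ad_tensor_scale[of e 0 "\<lambda>_. 0"] by simp

lemma ad_tensor_diff: "ad_tensor e (\<lambda>k. v k - w k) k = ad_tensor e v k - ad_tensor e w k"
  using ad_tensor_add[of e v "\<lambda>k. -1 * w k" k] ad_tensor_scale[of e "-1" w k] by simp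

lemma ad_tensor_sum: "ad_tensor e (\<lambda>k. \<Sum>t\<in>T. f t k) k = (\<Sum>t\<in>T. ad_tensor e (f t) k)"
  by (simp add: ad_tensor_def ad_sum sum.distrib sum_distrib_left)

lemma ad_tensor_ad_tensor:
  "ad_tensor e (ad_tensor f v) (b, c) = ad e (ad f (\<lambda>x. v (x, c))) b
      + sg (par f \<and> (par b \<noteq> par e)) * ad f (\<lambda>z. ad e (\<lambda>x. v (x, z)) b) c
      + sg (par e \<and> par b) * ad e (\<lambda>z. ad f (\<lambda>x. v (x, z)) b) c
      + sg (par e \<and> par b) * sg (par f \<and> par b) * ad e (ad f (\<lambda>x. v (b, x))) c"
  unfolding ad_tensor_def
  by (simp add: ad_add ad_scale ad_sg ad_commute distrib_left mult.assoc)

lemma ad_tensor_br: "(\<Sum>g\<in>supp (br e f). br e f g * ad_tensor g v k)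
    = ad_tensor e (ad_tensor f v) k - sg (par e \<and> par f) * ad_tensor f (ad_tensor e v) k"
proof -
  obtain b c where k: "k = (b, c)"
    by (cases k)
  have "(\<Sum>g\<in>supp (br e f). br e f g * ad_tensor g v (b, c))
    = (\<Sum>g\<in>supp (br e f). br e f g * ad g (\<lambda>x. v (x, c)) b
        + sg ((par e \<noteq> par f) \<and> par b) * (br e f g * ad g (\<lambda>x. v (b, x)) c))"
  proof (intro sum.cong refl)
    fix g
    assume "g \<in> supp (br e f)"
    then have "par g = (par e \<noteq> par f)"
      by (auto simp: supp_def dest: br_par)
    then show "br e f g * ad_tensor g v (b, c) = br e f g * ad g (\<lambda>x. v (x, c)) b
        + sg ((par e \<noteq> par f) \<and> par b) * (br e f g * ad g (\<lambda>x. v (b, x)) c)"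
      by (simp add: ad_tensor_def distrib_left)
  qed
  also have "\<dots> = ad e (ad f (\<lambda>x. v (x, c))) b
        - sg (par e \<and> par f) * ad f (ad e (\<lambda>x. v (x, c))) b
      + sg ((par e \<noteq> par f) \<and> par b) * (ad e (ad f (\<lambda>x. v (b, x))) c
        - sg (par e \<and> par f) * ad f (ad e (\<lambda>x. v (b, x))) c)"
    by (simp only: sum.distrib ad_br sum_distrib_left[symmetric])
  finally show ?thesis
    unfolding k ad_tensor_ad_tensor by (cases "par e"; cases "par f"; cases "par b") simp_all
qed

lemma actb_eq_ad_tensor: "actb e t k = ad_tensor e (\<lambda>x. if x = t then 1 else 0) k"
proof -
  have "(\<lambda>x. if (x, snd k) = t then 1 else 0)
      = (\<lambda>x. (if snd k = snd t then 1 else 0) * vec (fst t) 1 x)"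
    "(\<lambda>x. if (fst k, x) = t then 1 else 0)
      = (\<lambda>x. (if fst k = fst t then 1 else 0) * vec (snd t) 1 x)"
    by (rule ext, cases t, simp add: vec_def)+
  then show ?thesis
    unfolding ad_tensor_def actb_def tens_def br_eq_ad
    by (simp only: ad_scale) (auto simp: vec_def)
qed

lemma ad_tensor_eq_sum_actb:
  assumes "finite (supp v)"
  shows "ad_tensor e v k = (\<Sum>t\<in>supp v. v t * actb e t k)"
proof -
  have "v j = (\<Sum>t\<in>supp v. v t * (if j = t then 1 else 0))" for j
    using assms by (simp add: if_distrib[of "(*) _"] cong: if_cong) (simp add: supp_def)
  then have "v = (\<lambda>j. \<Sum>t\<in>supp v. v t * (if j = t then 1 else 0))"
    by blast
  then have "ad_tensor e v k = ad_tensor e (\<lambda>j. \<Sum>t\<in>supp v. v t * (if j = t then 1 else 0)) k"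
    by simp
  then show ?thesis
    by (simp only: ad_tensor_sum ad_tensor_scale actb_eq_ad_tensor)
qed

lemma act_eq_sum_ad_tensor:
  assumes "finite (supp v)"
  shows "act x v k = (\<Sum>e\<in>supp x. x e * ad_tensor e v k)"
  unfolding act_def ad_tensor_eq_sum_actb[OF assms] by (simp add: sum_distrib_left mult.assoc)

lemma act_vec: "finite (supp v) \<Longrightarrow> act (vec e c) v k = c * ad_tensor e v k"
  by (simp add: act_eq_sum_ad_tensor sum_supp_vec)

lemma act_scale_right:
  assumes "finite (supp v)"
  shows "act x (\<lambda>k. c * v k) k = c * act x v k"
proof -
  have "finite (supp (\<lambda>k. c * v k))"
    by (rule finite_subset[OF _ assms]) (auto simp: supp_def)
  with assms show ?thesis
    by (simp add: act_eq_sum_ad_tensor ad_tensor_scale[of _ c] sum_distrib_left mult.left_commute)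
qed

lemma actb_nonzero:
  assumes "actb e t k \<noteq> 0"
  shows "br e (fst t) (fst k) \<noteq> 0 \<and> snd k = snd t \<or> fst k = fst t \<and> br e (snd t) (snd k) \<noteq> 0"
  using assms unfolding actb_def tens_def vec_def by (auto split: if_splits)

definition tensor_par :: "B \<times> B \<Rightarrow> bool" where
  "tensor_par k \<longleftrightarrow> par (fst k) \<noteq> par (snd k)"

lemma actb_par: "actb e t k \<noteq> 0 \<Longrightarrow> tensor_par k = (par e \<noteq> tensor_par t)"
  using actb_nonzero[of e t k] br_par unfolding tensor_par_def by metis

lemma finite_supp_actb: "finite (supp (actb e t))"
proof (rule finite_subset)
  show "supp (actb e t) \<subseteq> supp (br e (fst t)) \<times> {snd t} \<union> {fst t} \<times> supp (br e (snd t))"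
    using actb_nonzero by (fastforce simp: supp_def)
qed (use finite_supp_br in blast)

lemma supp_sum_sum_subset:
  "supp (\<lambda>k. \<Sum>e\<in>A. \<Sum>t\<in>T. f e t * F e t k) \<subseteq> (\<Union>e\<in>A. \<Union>t\<in>T. supp (F e t))"
proof
  fix k
  assume "k \<in> supp (\<lambda>k. \<Sum>e\<in>A. \<Sum>t\<in>T. f e t * F e t k)"
  then obtain e where "e \<in> A" "(\<Sum>t\<in>T. f e t * F e t k) \<noteq> 0"
    unfolding supp_def by (auto elim: sum.not_neutral_contains_not_neutral)
  moreover from this obtain t where "t \<in> T" "F e t k \<noteq> 0"
    by (auto elim: sum.not_neutral_contains_not_neutral)
  ultimately show "k \<in> (\<Union>e\<in>A. \<Union>t\<in>T. supp (F e t))"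
    by (intro UN_I) (simp_all add: supp_def)
qed

lemma supp_act_subset: "supp (act x v) \<subseteq> (\<Union>e\<in>supp x. \<Union>t\<in>supp v. supp (actb e t))"
  unfolding act_def by (rule supp_sum_sum_subset)

lemma finite_supp_act:
  assumes "finite (supp x)" "finite (supp v)"
  shows "finite (supp (act x v))"
  by (rule finite_subset[OF supp_act_subset]) (use assms finite_supp_actb in blast)

lemma finite_supp_ad_tensor:
  assumes "finite (supp v)"
  shows "finite (supp (ad_tensor e v))"
proof -
  have "ad_tensor e v = act (vec e 1) v"
    by (simp add: fun_eq_iff act_vec[OF assms])
  then show ?thesis
    using finite_supp_act[OF finite_supp_vec assms] by simp
qed

lemma act_act:
  assumes "finite (supp x)" "finite (supp y)" "finite (supp v)"
  shows "act x (act y v) k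
    = (\<Sum>c\<in>supp x. \<Sum>d\<in>supp y. x c * y d * ad_tensor c (ad_tensor d v) k)"
proof -
  have "act y v = (\<lambda>k. \<Sum>d\<in>supp y. y d * ad_tensor d v k)"
    using act_eq_sum_ad_tensor[OF assms(3)] by blast
  then have "ad_tensor c (act y v) k = (\<Sum>d\<in>supp y. y d * ad_tensor c (ad_tensor d v) k)" for c
    by (simp only: ad_tensor_sum ad_tensor_scale)
  then show ?thesis
    using act_eq_sum_ad_tensor[OF finite_supp_act[OF assms(2,3)], of x k]
    by (simp add: sum_distrib_left mult.assoc)
qed

lemma supp_brk_subset: "supp (brk x y) \<subseteq> (\<Union>c\<in>supp x. \<Union>d\<in>supp y. supp (br c d))"
  unfolding brk_def by (rule supp_sum_sum_subset)

lemma brk_vec: "brk (vec e 1) (vec f 1) = br e f"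
proof
  fix b
  have "supp (vec e 1) = {e}" "supp (vec f 1) = {f}"
    by (auto simp: supp_def vec_def)
  then show "brk (vec e 1) (vec f 1) b = br e f b"
    unfolding brk_def by (simp add: vec_def)
qed

lemma sum_brk:
  assumes x: "finite (supp x)" and y: "finite (supp y)"
  shows "(\<Sum>g\<in>supp (brk x y). brk x y g * F g)
    = (\<Sum>c\<in>supp x. \<Sum>d\<in>supp y. x c * y d * (\<Sum>g\<in>supp (br c d). br c d g * F g))"
proof -
  let ?T = "\<Union>c\<in>supp x. \<Union>d\<in>supp y. supp (br c d)"
  have T: "finite ?T"
    using x y finite_supp_br by blast
  have "(\<Sum>g\<in>supp (brk x y). brk x y g * F g) = (\<Sum>g\<in>?T. brk x y g * F g)"
    by (rule sum_supp_superset[OF T supp_brk_subset])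
  also have "\<dots> = (\<Sum>g\<in>?T. \<Sum>c\<in>supp x. \<Sum>d\<in>supp y. x c * y d * (br c d g * F g))"
    unfolding brk_def by (simp add: sum_distrib_right mult.assoc)
  also have "\<dots> = (\<Sum>c\<in>supp x. \<Sum>d\<in>supp y. \<Sum>g\<in>?T. x c * y d * (br c d g * F g))"
    by (subst sum.swap, rule sum.cong[OF refl], rule sum.swap)
  also have "\<dots> = (\<Sum>c\<in>supp x. \<Sum>d\<in>supp y. x c * y d * (\<Sum>g\<in>?T. br c d g * F g))"
    by (simp only: sum_distrib_left)
  also have "\<dots> = (\<Sum>c\<in>supp x. \<Sum>d\<in>supp y. x c * y d * (\<Sum>g\<in>supp (br c d). br c d g * F g))"
  proof (intro sum.cong refl)
    fix c d
    assume "c \<in> supp x" "d \<in> supp y"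
    then have "(\<Sum>g\<in>?T. br c d g * F g) = (\<Sum>g\<in>supp (br c d). br c d g * F g)"
      by (intro sum_supp_superset[OF T, symmetric]) blast
    then show "x c * y d * (\<Sum>g\<in>?T. br c d g * F g)
        = x c * y d * (\<Sum>g\<in>supp (br c d). br c d g * F g)"
      by (rule arg_cong)
  qed
  finally show ?thesis .
qed

lemma act_brk:
  assumes x: "finite (supp x)" "\<forall>b\<in>supp x. par b = qx"
    and y: "finite (supp y)" "\<forall>b\<in>supp y. par b = qy" and v: "finite (supp v)"
  shows "act (brk x y) v k = act x (act y v) k - sg (qx \<and> qy) * act y (act x v) k"
proof -
  have "act (brk x y) v k = (\<Sum>c\<in>supp x. \<Sum>d\<in>supp y. x c * y d *
      (ad_tensor c (ad_tensor d v) k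
        - sg (par c \<and> par d) * ad_tensor d (ad_tensor c v) k))"
    unfolding act_eq_sum_ad_tensor[OF v] sum_brk[OF x(1) y(1)] ad_tensor_br ..
  also have "\<dots> = (\<Sum>c\<in>supp x. \<Sum>d\<in>supp y. x c * y d *
      (ad_tensor c (ad_tensor d v) k - sg (qx \<and> qy) * ad_tensor d (ad_tensor c v) k))"
    using x(2) y(2) by simp
  also have "\<dots> = act x (act y v) k - sg (qx \<and> qy) * act y (act x v) k"
    unfolding act_act[OF x(1) y(1) v] act_act[OF y(1) x(1) v] sum.swap[of _ "supp y"]
    by (simp add: right_diff_distrib sum_subtractf sum_distrib_left mult_ac)
  finally show ?thesis .
qed

section \<open>Cocycles of the Witt algebra in the tensor square\<close>

fun grade :: "B \<Rightarrow> real" where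
  "grade (L p) = p" | "grade (I p) = p" | "grade (G p) = p" | "grade (H p) = p"

fun density :: "B \<Rightarrow> real" where
  "density (L p) = 1" | "density (I p) = 1" | "density (G p) = 1 / 2" | "density (H p) = 1 / 2"

fun shift :: "real \<Rightarrow> B \<Rightarrow> B" where
  "shift x (L p) = L (p + x)" | "shift x (I p) = I (p + x)"
| "shift x (G p) = G (p + x)" | "shift x (H p) = H (p + x)"

lemma shift_shift [simp]: "shift x (shift y b) = shift (y + x) b"
  by (cases b) simp_all

lemma shift_0 [simp]: "shift 0 b = b"
  by (cases b) simp_all

lemma inj_shift: "inj (shift x)"
  by (rule inj_on_inverseI[of _ "shift (- x)"]) simp

lemma grade_shift [simp]: "grade (shift x b) = grade b + x"
  by (cases b) simp_all

lemma density_shift [simp]: "density (shift x b) = density b"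
  by (cases b) simp_all

lemma par_shift [simp]: "par (shift x b) = par b"
  by (cases b) simp_all

lemma density_ge_half: "density b \<ge> 1 / 2"
  by (cases b) simp_all

lemma density_pos: "density b > 0"
  using density_ge_half[of b] by linarith

lemma br_L: "br (L p) e = vec (shift p e) (of_real (density e * p - grade e))"
  by (cases e) (simp_all add: add.commute)

lemma ad_tensor_L: "ad_tensor (L p) v (b, c)
    = of_real ((density b + 1) * p - grade b) * v (shift (- p) b, c)
    + of_real ((density c + 1) * p - grade c) * v (b, shift (- p) c)"
  unfolding ad_tensor_def by (cases b; cases c) (simp_all add: algebra_simps)

definition witt_cocycle :: "real \<Rightarrow> (int \<Rightarrow> B \<times> B \<Rightarrow> complex) \<Rightarrow> bool" where
  "witt_cocycle g D \<longleftrightarrow> (\<forall>m n k. of_real (of_int (m - n) * g) * D (m + n) k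
     = ad_tensor (L (of_int m * g)) (D n) k - ad_tensor (L (of_int n * g)) (D m) k)"

lemma witt_cocycleD:
  assumes "witt_cocycle g D"
  shows "of_real (of_int (m - n) * g) * D (m + n) k
    = ad_tensor (L (of_int m * g)) (D n) k - ad_tensor (L (of_int n * g)) (D m) k"
  using assms unfolding witt_cocycle_def by blast

lemma witt_cocycle_ad_tensor: "witt_cocycle g (\<lambda>n. ad_tensor (L (of_int n * g)) v)"
  unfolding witt_cocycle_def
proof (intro allI)
  fix m n k
  show "of_real (of_int (m - n) * g) * ad_tensor (L (of_int (m + n) * g)) v k
    = ad_tensor (L (of_int m * g)) (ad_tensor (L (of_int n * g)) v) k
    - ad_tensor (L (of_int n * g)) (ad_tensor (L (of_int m * g)) v) k"
    using ad_tensor_br[of "L (of_int m * g)" "L (of_int n * g)" v k]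
    unfolding br.simps sum_supp_vec by (simp add: algebra_simps)
qed

lemma witt_cocycle_diff:
  assumes "witt_cocycle g D" "witt_cocycle g D'"
  shows "witt_cocycle g (\<lambda>n k. D n k - D' n k)"
  unfolding witt_cocycle_def ad_tensor_diff right_diff_distrib
  using assms[THEN witt_cocycleD] by simp

definition vanishes_below :: "real \<Rightarrow> (B \<times> B \<Rightarrow> complex) \<Rightarrow> bool" where
  "vanishes_below A v \<longleftrightarrow> (\<forall>b c. grade c < A \<longrightarrow> v (b, c) = 0)"

lemma vanishes_below_mono: "vanishes_below A v \<Longrightarrow> A' \<le> A \<Longrightarrow> vanishes_below A' v"
  unfolding vanishes_below_def by auto

lemma vanishes_below_diff:
  assumes "vanishes_below A v" "vanishes_below A' w"
  shows "vanishes_below (min A A') (\<lambda>k. v k - w k)"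
  using assms unfolding vanishes_below_def by simp

lemma finite_supp_imp_vanishes_below:
  assumes "finite (supp v)"
  shows "\<exists>A. vanishes_below A v"
proof -
  let ?A = "Min (insert 0 (grade ` snd ` supp v))"
  have "grade c \<ge> ?A" if "v (b, c) \<noteq> 0" for b c
    using that assms by (intro Min_le) (force simp: supp_def)+
  then show ?thesis
    unfolding vanishes_below_def by (meson not_less)
qed

lemma ad_tensor_L_vanishes_below:
  assumes "vanishes_below A v"
  shows "vanishes_below (min A (A + p)) (ad_tensor (L p) v)"
  using assms unfolding vanishes_below_def ad_tensor_L by simp

lemma eventually_of_int_mult_gt:
  assumes "g > (0::real)"
  shows "\<forall>\<^sub>F n :: int in at_top. C < of_int n * g"
proof -
  have "C < of_int n * g" if "n \<ge> \<lfloor>C / g\<rfloor> + 1" for n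
  proof -
    have "C / g < of_int n"
      using that by linarith
    with assms show ?thesis
      by (simp add: field_simps)
  qed
  then show ?thesis
    unfolding eventually_at_top_linorder by blast
qed

lemma vanishes_below_eventually_shift:
  assumes "vanishes_below A v" "g > 0"
  shows "\<forall>\<^sub>F n in at_top. \<forall>b. v (b, shift (- (of_int n * g)) c) = 0"
  using eventually_of_int_mult_gt[OF assms(2), of "grade c - A"]
proof eventually_elim
  case (elim n)
  then show ?case
    using assms(1) unfolding vanishes_below_def by simp
qed

lemma eventually_at_top_int_shift:
  assumes "\<forall>\<^sub>F n in at_top. P (n :: int)"
  shows "\<forall>\<^sub>F n in at_top. P (n + m)"
proof -
  obtain M where "P n" if "n \<ge> M" for n
    using assms unfolding eventually_at_top_linorder by blast
  then have "P (n + m)" if "n \<ge> M - m" for n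
    using that by simp
  then show ?thesis
    unfolding eventually_at_top_linorder by blast
qed

lemma ad_tensor_L_vanishes_below_nonneg:
  assumes "vanishes_below A v" "p \<ge> 0"
  shows "vanishes_below A (ad_tensor (L p) v)"
  using ad_tensor_L_vanishes_below[OF assms(1), of p] assms(2) by simp

lemma witt_cocycle_vanishes_below_from_2:
  assumes D: "witt_cocycle g D" and "g > 0"
    and A: "vanishes_below A (D 1)" "vanishes_below A (D 2)" and "n \<ge> 2"
  shows "vanishes_below A (D n)"
  using \<open>n \<ge> 2\<close>
proof (induction n rule: int_ge_induct)
  case base
  show ?case
    by fact
next
  case (step n)
  show ?case
    unfolding vanishes_below_def
  proof (intro allI impI)
    fix b c
    assume "grade c < A"
    then have "of_real (of_int (n - 1) * g) * D (n + 1) (b, c) = 0"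
      unfolding witt_cocycleD[OF D]
      using ad_tensor_L_vanishes_below_nonneg[OF A(1), of "of_int n * g"]
        ad_tensor_L_vanishes_below_nonneg[OF step.IH, of "of_int 1 * g"] \<open>g > 0\<close> step.hyps
      unfolding vanishes_below_def by simp
    with \<open>g > 0\<close> step.hyps show "D (n + 1) (b, c) = 0"
      by (simp only: mult_eq_0_iff of_real_eq_0_iff of_int_eq_0_iff) auto
  qed
qed

lemma witt_cocycle_vanishes_below:
  assumes D: "witt_cocycle g D" and "g > 0" and fin: "\<And>n. finite (supp (D n))"
  obtains A where "\<And>n. n \<ge> 1 \<Longrightarrow> vanishes_below A (D n)"
proof -
  obtain A\<^sub>1 A\<^sub>2 where "vanishes_below A\<^sub>1 (D 1)" "vanishes_below A\<^sub>2 (D 2)"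
    using fin finite_supp_imp_vanishes_below by metis
  then obtain A where A: "vanishes_below A (D 1)" "vanishes_below A (D 2)"
    using vanishes_below_mono min.cobounded1 min.cobounded2 by metis
  have "vanishes_below A (D n)" if "n \<ge> 1" for n
    using that A(1) witt_cocycle_vanishes_below_from_2[OF D \<open>g > 0\<close> A, of n]
    by (cases "n = 1") auto
  with that show ?thesis .
qed

lemma witt_cocycle_column_density_cocycle:
  assumes D: "witt_cocycle g D" and "g > 0" and below: "\<And>n. n \<ge> 1 \<Longrightarrow> vanishes_below A (D n)"
    and N: "N \<ge> 1" "grade c < A + of_int N * g"
  shows "density_cocycle (density b) (- grade b / g) N (\<lambda>n. D n (shift (of_int n * g) b, c))"
  unfolding density_cocycle_def
proof (intro allI impI)
  fix m n
  assume mn: "N \<le> m" "N \<le> n"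
  let ?h = "\<lambda>n. D n (shift (of_int n * g) b, c)"
  have act: "ad_tensor (L (of_int i * g)) (D j) (shift (of_int (m + n) * g) b, c)
      = of_real g * (of_real (density b * of_int i - of_int j + - grade b / g) * ?h j)"
    if "i + j = m + n" "i \<ge> N" "j \<ge> N" for i j
  proof -
    have "of_int N * g \<le> of_int i * g"
      using that \<open>g > 0\<close> by simp
    then have "D j (b', shift (- (of_int i * g)) c) = 0" for b'
      using below[of j] that N unfolding vanishes_below_def by simp
    moreover have "of_int (m + n) * g = of_int i * g + of_int j * g"
      unfolding that(1)[symmetric] by (simp add: distrib_right)
    moreover have "(density b + 1) * (of_int i * g) - (grade b + (of_int i * g + of_int j * g))
        = g * (density b * of_int i - of_int j + - grade b / g)"
      using \<open>g > 0\<close> by (simp add: field_simps)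
    ultimately show ?thesis
      unfolding ad_tensor_L by (simp only: grade_shift density_shift shift_shift) simp
  qed
  have "of_real g * (of_int (m - n) * ?h (m + n))
      = of_real (of_int (m - n) * g) * D (m + n) (shift (of_int (m + n) * g) b, c)"
    by simp
  also have "\<dots> = of_real g *
      (of_real (density b * of_int m - of_int n + - grade b / g) * ?h n
     - of_real (density b * of_int n - of_int m + - grade b / g) * ?h m)"
    unfolding witt_cocycleD[OF D] using mn by (simp only: act add.commute right_diff_distrib)
  finally show "of_int (m - n) * ?h (m + n) =
      of_real (density b * of_int m - of_int n + - grade b / g) * ?h n
    - of_real (density b * of_int n - of_int m + - grade b / g) * ?h m"
    using \<open>g > 0\<close> by (simp only: mult_cancel_left) simp
qed

lemma witt_cocycle_column_asymptotic:
  assumes D: "witt_cocycle g D" and "g > 0" and below: "\<And>n. n \<ge> 1 \<Longrightarrow> vanishes_below A (D n)"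
  shows "\<exists>z. (grade c < A \<longrightarrow> z = 0) \<and> (\<forall>\<^sub>F n in at_top. D n (shift (of_int n * g) b, c)
    = of_real (density b * (of_int n * g) - grade b) * z)"
proof (cases "grade c < A")
  case True
  have "\<forall>\<^sub>F n in at_top. D n (shift (of_int n * g) b, c) = 0"
    using eventually_ge_at_top[of 1]
  proof eventually_elim
    case (elim n)
    then show ?case
      using below[of n] True unfolding vanishes_below_def by simp
  qed
  then show ?thesis
    by (intro exI[of _ 0]) simp
next
  case False
  have "\<forall>\<^sub>F n in at_top. n \<ge> 1 \<and> grade c - A < of_int n * g"
    by (intro eventually_conj eventually_ge_at_top eventually_of_int_mult_gt \<open>g > 0\<close>)
  then obtain N where "N \<ge> 1" "grade c - A < of_int N * g"
    unfolding eventually_at_top_linorder by (meson order_refl)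
  then have column:
    "density_cocycle (density b) (- grade b / g) N (\<lambda>n. D n (shift (of_int n * g) b, c))"
    by (intro witt_cocycle_column_density_cocycle[OF D \<open>g > 0\<close> below]) auto
  obtain z where "\<forall>\<^sub>F n in at_top. D n (shift (of_int n * g) b, c)
      = z * of_real (density b * of_int n + - grade b / g)"
    using density_cocycle_eventually_principal[OF column density_pos] by (elim exE)
  moreover have "z * of_real (density b * of_int n + - grade b / g)
      = of_real (density b * (of_int n * g) - grade b) * (z / of_real g)" for n
    using \<open>g > 0\<close> by (simp add: field_simps)
  ultimately show ?thesis
    using False by (intro exI[of _ "z / of_real g"]) simp
qed

lemma witt_cocycle_asymptotic:
  assumes D: "witt_cocycle g D" and "g > 0" and fin: "\<And>n. finite (supp (D n))"
  shows "\<exists>A v. vanishes_below A v \<and> (\<forall>b c. \<forall>\<^sub>F n in at_top. D n (shift (of_int n * g) b, c)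
    = of_real (density b * (of_int n * g) - grade b) * v (b, c))"
proof -
  obtain A where A: "\<And>n. n \<ge> 1 \<Longrightarrow> vanishes_below A (D n)"
    using witt_cocycle_vanishes_below[OF assms] by blast
  define P where "P = (\<lambda>(b, c) z. (grade c < A \<longrightarrow> z = 0) \<and>
      (\<forall>\<^sub>F n in at_top. D n (shift (of_int n * g) b, c)
        = of_real (density b * (of_int n * g) - grade b) * z))"
  have "\<exists>z. P k z" for k
    unfolding P_def using witt_cocycle_column_asymptotic[OF D \<open>g > 0\<close> A] by (cases k) simp
  then obtain v where "\<And>k. P k (v k)"
    by metis
  then have "P (b, c) (v (b, c))" for b c
    by blast
  then show ?thesis
    unfolding P_def vanishes_below_def by (intro exI[of _ A] exI[of _ v]) simp
qed

lemma witt_cocycle_eq_0_if_eventually_0: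
  assumes D: "witt_cocycle g D" and "g > 0" and below: "\<And>n. \<exists>A. vanishes_below A (D n)"
    and asymp: "\<And>b c. \<forall>\<^sub>F n in at_top. D n (shift (of_int n * g) b, c) = 0"
  shows "D n (b, c) = 0"
proof -
  let ?q = "of_int n * g"
  obtain A where A: "vanishes_below A (D n)"
    using below by blast
  have "\<forall>\<^sub>F m in at_top. D (m + n) (shift (of_int (m + n) * g) (shift (- ?q) b), c) = 0"
    by (rule eventually_at_top_int_shift) (rule asymp)
  moreover have "\<forall>\<^sub>F m in at_top. D m (shift (of_int m * g) (shift (- ?q) b), c) = 0"
    by (rule asymp)
  moreover have "\<forall>\<^sub>F m in at_top. D m (shift (of_int m * g) b, shift (- ?q) c) = 0"
    by (rule asymp)
  moreover have "\<forall>\<^sub>F m in at_top. \<forall>b. D n (b, shift (- (of_int m * g)) c) = 0"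
    by (rule vanishes_below_eventually_shift[OF A \<open>g > 0\<close>])
  moreover have "\<forall>\<^sub>F m in at_top. grade b / density b < of_int m * g"
    by (rule eventually_of_int_mult_gt[OF \<open>g > 0\<close>])
  ultimately have "\<forall>\<^sub>F m :: int in at_top. D n (b, c) = 0"
  proof eventually_elim
    case (elim m)
    let ?p = "of_int m * g"
    have "ad_tensor (L ?p) (D n) (shift ?p b, c) - ad_tensor (L ?q) (D m) (shift ?p b, c) = 0"
      using elim(1) unfolding witt_cocycleD[OF D, symmetric] by (simp add: algebra_simps)
    moreover have "ad_tensor (L ?q) (D m) (shift ?p b, c) = 0"
      using elim(2,3) unfolding ad_tensor_L by (simp add: algebra_simps)
    moreover have "ad_tensor (L ?p) (D n) (shift ?p b, c)
        = of_real (density b * ?p - grade b) * D n (b, c)"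
      using elim(4) unfolding ad_tensor_L by (simp add: algebra_simps)
    ultimately have "of_real (density b * ?p - grade b) * D n (b, c) = 0"
      by simp
    moreover have "density b * ?p - grade b \<noteq> 0"
      using elim(5) density_pos[of b] by (simp add: field_simps)
    ultimately show ?case
      by (simp only: mult_eq_0_iff of_real_eq_0_iff) simp
  qed
  then show ?thesis
    by simp
qed

definition two_step_set :: "real \<Rightarrow> (B \<times> B \<Rightarrow> complex) \<Rightarrow> (B \<times> B) set" where
  "two_step_set p v = map_prod (shift p) id -` supp (ad_tensor (L p) v)
     \<union> map_prod (shift (2 * p)) (shift (- p)) -` supp (ad_tensor (L p) v)
     \<union> map_prod (shift (2 * p)) id -` supp (ad_tensor (L (2 * p)) v)"

lemma finite_two_step_set:
  assumes "finite (supp (ad_tensor (L p) v))" "finite (supp (ad_tensor (L (2 * p)) v))"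
  shows "finite (two_step_set p v)"
  unfolding two_step_set_def
  using assms by (intro finite_UnI finite_vimageI prod.inj_map inj_shift inj_on_id)

text \<open>Outside \<open>two_step_set p v\<close>, going from \<open>(b, c)\<close> to \<open>(shift (2 * p) b, shift (- 2 * p) c)\<close> by
  two steps of length \<open>p\<close> or by one step of length \<open>2 * p\<close> multiplies \<open>v\<close> by different factors.\<close>
lemma two_steps_versus_double_step:
  assumes "grade b + grade c = 0" and "v (b, c) \<noteq> 0" and "p \<noteq> 0"
    and "(b, c) \<notin> two_step_set p v"
  shows "(density c - density b) * grade b = 2 * density b * (density c + 1) * p"
proof -
  define x \<alpha> \<beta> where "x = grade b" and "\<alpha> = density b" and "\<beta> = density c"
  let ?v\<^sub>1 = "v (shift p b, shift (- p) c)"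
  let ?v\<^sub>2 = "v (shift (2 * p) b, shift (- (2 * p)) c)"
  have c: "grade c = - x"
    using assms(1) by (simp add: x_def)
  have "of_real (\<alpha> * p - x) * v (b, c) + of_real (\<beta> * p + p + x) * ?v\<^sub>1 = 0"
    "of_real (\<alpha> * p - p - x) * ?v\<^sub>1 + of_real (\<beta> * p + 2 * p + x) * ?v\<^sub>2 = 0"
    "of_real (2 * \<alpha> * p - x) * v (b, c) + of_real (2 * \<beta> * p + 2 * p + x) * ?v\<^sub>2 = 0"
    using assms(4) c unfolding two_step_set_def supp_def
    by (simp_all add: ad_tensor_L x_def \<alpha>_def \<beta>_def algebra_simps)
  then have "of_real ((2 * \<alpha> * p - x) * (\<beta> * p + p + x) * (\<beta> * p + 2 * p + x)
      + (2 * \<beta> * p + 2 * p + x) * (\<alpha> * p - p - x) * (\<alpha> * p - x)) * v (b, c) = 0"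
    unfolding of_real_add of_real_mult by algebra
  then have "(2 * \<alpha> * p - x) * (\<beta> * p + p + x) * (\<beta> * p + 2 * p + x)
      + (2 * \<beta> * p + 2 * p + x) * (\<alpha> * p - p - x) * (\<alpha> * p - x) = 0"
    using assms(2) by (simp only: mult_eq_0_iff of_real_eq_0_iff) simp
  moreover have "(2 * \<alpha> * p - x) * (\<beta> * p + p + x) * (\<beta> * p + 2 * p + x)
      + (2 * \<beta> * p + 2 * p + x) * (\<alpha> * p - p - x) * (\<alpha> * p - x)
    = p\<^sup>2 * (\<alpha> + \<beta> + 1) * (2 * \<alpha> * (\<beta> + 1) * p - (\<beta> - \<alpha>) * x)"
    by algebra
  moreover have "p\<^sup>2 * (\<alpha> + \<beta> + 1) \<noteq> 0"
    using density_pos[of b] density_pos[of c] \<open>p \<noteq> 0\<close> by (simp add: \<alpha>_def \<beta>_def)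
  ultimately show ?thesis
    unfolding \<alpha>_def \<beta>_def x_def by simp
qed


lemma finite_supp_if_finite_supp_ad_tensor:
  assumes "g \<noteq> 0" and fin: "\<And>p. p \<in> {0, g, 2 * g, 4 * g} \<Longrightarrow> finite (supp (ad_tensor (L p) v))"
  shows "finite (supp v)"
proof (rule finite_subset)
  show "supp v \<subseteq> supp (ad_tensor (L 0) v) \<union> two_step_set g v \<union> two_step_set (2 * g) v"
  proof (rule subrelI, rule ccontr)
    fix b c
    assume bc: "(b, c) \<in> supp v"
      and "(b, c) \<notin> supp (ad_tensor (L 0) v) \<union> two_step_set g v \<union> two_step_set (2 * g) v"
    then have v: "v (b, c) \<noteq> 0" and "ad_tensor (L 0) v (b, c) = 0"
      and notin: "(b, c) \<notin> two_step_set g v" "(b, c) \<notin> two_step_set (2 * g) v"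
      by (simp_all add: supp_def)
    moreover have "ad_tensor (L 0) v (b, c) = - (of_real (grade b + grade c) * v (b, c))"
      unfolding ad_tensor_L by (simp add: algebra_simps)
    ultimately have total: "grade b + grade c = 0"
      by (simp only: neg_equal_0_iff_equal mult_eq_0_iff of_real_eq_0_iff) simp
    have "2 * density b * (density c + 1) * g = 2 * density b * (density c + 1) * (2 * g)"
      using \<open>g \<noteq> 0\<close> two_steps_versus_double_step[where v = v, OF total v _ notin(1)]
        two_steps_versus_double_step[where v = v, OF total v _ notin(2)] by simp
    with density_pos[of b] density_pos[of c] \<open>g \<noteq> 0\<close> show False
      by simp
  qed
  show "finite (supp (ad_tensor (L 0) v) \<union> two_step_set g v \<union> two_step_set (2 * g) v)"
    using fin by (simp add: finite_two_step_set)
qed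

theorem witt_cocycle_is_coboundary:
  assumes D: "witt_cocycle g D" and "g > 0" and fin: "\<And>n. finite (supp (D n))"
  shows "\<exists>v. finite (supp v) \<and> (\<forall>n. D n = ad_tensor (L (of_int n * g)) v)"
proof -
  obtain A v where v: "vanishes_below A v"
    and asymp: "\<forall>b c. \<forall>\<^sub>F n in at_top. D n (shift (of_int n * g) b, c)
        = of_real (density b * (of_int n * g) - grade b) * v (b, c)"
    using witt_cocycle_asymptotic[OF assms] by (elim exE conjE)
  define E where "E n = (\<lambda>k. D n k - ad_tensor (L (of_int n * g)) v k)" for n
  have E: "witt_cocycle g E"
    unfolding E_def by (intro witt_cocycle_diff D witt_cocycle_ad_tensor)
  have below: "\<exists>A. vanishes_below A (E n)" for n
    using finite_supp_imp_vanishes_below[OF fin] ad_tensor_L_vanishes_below[OF v]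
      vanishes_below_diff unfolding E_def by meson
  have E_asymp: "\<forall>\<^sub>F n in at_top. E n (shift (of_int n * g) b, c) = 0" for b c
    using asymp[rule_format, of b c] vanishes_below_eventually_shift[OF v \<open>g > 0\<close>, of c]
  proof eventually_elim
    case (elim n)
    then show ?case
      unfolding E_def ad_tensor_L by (simp add: algebra_simps)
  qed
  have "E n (b, c) = 0" for n b c
    by (rule witt_cocycle_eq_0_if_eventually_0[OF E \<open>g > 0\<close> below E_asymp])
  then have D_eq: "D n = ad_tensor (L (of_int n * g)) v" for n
    unfolding E_def by (simp add: fun_eq_iff)
  have "finite (supp v)"
  proof (rule finite_supp_if_finite_supp_ad_tensor[of g])
    show "g \<noteq> 0"
      using \<open>g > 0\<close> by simp
    show "finite (supp (ad_tensor (L p) v))" if "p \<in> {0, g, 2 * g, 4 * g}" for p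
      using that fin[of 0] fin[of 1] fin[of 2] fin[of 4] unfolding D_eq by auto
  qed
  with D_eq show ?thesis
    by blast
qed

lemma finite_supp_grade_bounded:
  assumes "finite (supp (v :: B \<times> B \<Rightarrow> complex))"
  obtains C where "C \<ge> 0" "\<forall>b c. v (b, c) \<noteq> 0 \<longrightarrow> \<bar>grade b\<bar> \<le> C \<and> \<bar>grade c\<bar> \<le> C"
proof -
  let ?A = "insert 0 ((\<lambda>k. max \<bar>grade (fst k)\<bar> \<bar>grade (snd k)\<bar>) ` supp v)"
  have "max \<bar>grade b\<bar> \<bar>grade c\<bar> \<le> Max ?A" if "v (b, c) \<noteq> 0" for b c
    using that assms by (intro Max_ge) (force simp: supp_def)+
  moreover have "0 \<le> Max ?A"
    using assms by simp
  ultimately show ?thesis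
    by (intro that[of "Max ?A"]) simp_all
qed

lemma ad_tensor_L_separates:
  assumes bound: "\<forall>b c. v (b, c) \<noteq> 0 \<longrightarrow> \<bar>grade b\<bar> \<le> C \<and> \<bar>grade c\<bar> \<le> C"
    and p: "2 * C < p" "0 < p" and bc: "v (b, c) \<noteq> 0"
  shows "ad_tensor (L (3 * p)) v (shift (2 * p) b, shift p c) = 0"
    and "ad_tensor (L (2 * p)) (ad_tensor (L p) v) (shift (2 * p) b, shift p c)
      = of_real (density b * (2 * p) - grade b) * of_real (density c * p - grade c) * v (b, c)"
proof -
  have "v (shift x b, d) = 0" if "\<bar>x\<bar> \<ge> p" for x d
    using bound[rule_format, OF bc] bound[rule_format, of "shift x b" d] p that by force
  then show "ad_tensor (L (3 * p)) v (shift (2 * p) b, shift p c) = 0"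
    "ad_tensor (L (2 * p)) (ad_tensor (L p) v) (shift (2 * p) b, shift p c)
      = of_real (density b * (2 * p) - grade b) * of_real (density c * p - grade c) * v (b, c)"
    using p unfolding ad_tensor_L by (simp_all add: ad_tensor_L algebra_simps)
qed

section \<open>Inner derivations\<close>

definition inner_on_basis :: "bool \<Rightarrow> (B \<times> B \<Rightarrow> complex) \<Rightarrow> B \<Rightarrow> B \<times> B \<Rightarrow> complex" where
  "inner_on_basis P a e k = sg (P \<and> par e) * ad_tensor e a k"

lemma supp_evp_subset: "supp (evp x) \<subseteq> supp x"
  by (auto simp: supp_def evp_def)

lemma supp_odp_subset: "supp (odp x) \<subseteq> supp x"
  by (auto simp: supp_def odp_def)

lemma inn_homogeneous:
  assumes "\<forall>b\<in>supp x. par b = q"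
  shows "inn P a x = (\<lambda>k. sg (P \<and> q) * act x a k)"
proof -
  have hom: "x b = 0 \<or> par b = q" for b
    using assms by (auto simp: supp_def)
  have "evp x = (if q then (\<lambda>_. 0) else x)" "odp x = (if q then x else (\<lambda>_. 0))"
    by (rule ext, use hom in \<open>force simp: evp_def odp_def\<close>)+
  moreover have "act (\<lambda>_. 0) a k = 0" for k
    by (simp add: act_def supp_def)
  ultimately show ?thesis
    by (auto simp: inn_def)
qed

lemma supp_inn_subset: "supp (inn P a x) \<subseteq> (\<Union>e\<in>supp x. \<Union>t\<in>supp a. supp (actb e t))"
proof -
  have "supp (act z a) \<subseteq> (\<Union>e\<in>supp x. \<Union>t\<in>supp a. supp (actb e t))"
    if "supp z \<subseteq> supp x" for z
    using supp_act_subset UN_mono[OF that] by (rule order_trans) simp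
  from this[OF supp_evp_subset] this[OF supp_odp_subset]
  have "supp (act (evp x) a) \<union> supp (act (odp x) a)
      \<subseteq> (\<Union>e\<in>supp x. \<Union>t\<in>supp a. supp (actb e t))"
    by (rule Un_least)
  moreover have "supp (inn P a x) \<subseteq> supp (act (evp x) a) \<union> supp (act (odp x) a)"
    by (auto simp: supp_def inn_def)
  ultimately show ?thesis
    by (rule order_trans[rotated])
qed

lemma finite_supp_inn:
  assumes "finite (supp x)" "finite (supp a)"
  shows "finite (supp (inn P a x))"
  by (rule finite_subset[OF supp_inn_subset]) (use assms finite_supp_actb in blast)

lemma inn_eq_sum:
  assumes a: "finite (supp a)" and T: "finite T" "supp x \<subseteq> T"
  shows "inn P a x k = (\<Sum>e\<in>T. x e * inner_on_basis P a e k)"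
proof -
  have "supp (evp x) \<subseteq> T" "supp (odp x) \<subseteq> T"
    using T(2) supp_evp_subset supp_odp_subset by blast+
  then have "inn P a x k
      = (\<Sum>e\<in>T. evp x e * ad_tensor e a k) + sg P * (\<Sum>e\<in>T. odp x e * ad_tensor e a k)"
    unfolding inn_def act_eq_sum_ad_tensor[OF a]
    using sum_supp_superset[OF T(1), where F = "\<lambda>e. ad_tensor e a k"] by simp
  also have "\<dots> = (\<Sum>e\<in>T. x e * inner_on_basis P a e k)"
    unfolding sum_distrib_left sum.distrib[symmetric]
    by (rule sum.cong) (auto simp: evp_def odp_def inner_on_basis_def)
  finally show ?thesis .
qed

lemma inn_add:
  assumes "finite (supp a)" "finite (supp x)" "finite (supp y)"
  shows "inn P a (\<lambda>b. x b + y b) k = inn P a x k + inn P a y k"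
proof -
  have "finite (supp x \<union> supp y)" "supp (\<lambda>b. x b + y b) \<subseteq> supp x \<union> supp y"
    using assms by (auto simp: supp_def)
  then show ?thesis
    using inn_eq_sum[OF assms(1), of "supp x \<union> supp y"] by (simp add: distrib_right sum.distrib)
qed

lemma inn_scale:
  assumes "finite (supp a)" "finite (supp x)"
  shows "inn P a (\<lambda>b. c * x b) k = c * inn P a x k"
proof -
  have "supp (\<lambda>b. c * x b) \<subseteq> supp x"
    by (auto simp: supp_def)
  then show ?thesis
    by (simp add: inn_eq_sum[OF assms] sum_distrib_left mult.assoc)
qed

lemma inn_brk:
  assumes x: "finite (supp x)" "\<forall>b\<in>supp x. par b = qx"
    and y: "finite (supp y)" "\<forall>b\<in>supp y. par b = qy" and a: "finite (supp a)"
  shows "inn P a (brk x y) k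
    = sg (P \<and> qx) * act x (inn P a y) k - sg (qy \<and> (P \<noteq> qx)) * act y (inn P a x) k"
proof -
  have "par b = (qx \<noteq> qy)" if b: "b \<in> supp (brk x y)" for b
  proof -
    obtain c d where "c \<in> supp x" "d \<in> supp y" "b \<in> supp (br c d)"
      using b supp_brk_subset by blast
    then show ?thesis
      using br_par[of c d b] x(2) y(2) by (simp add: supp_def)
  qed
  then have hom: "\<forall>b\<in>supp (brk x y). par b = (qx \<noteq> qy)"
    by blast
  show ?thesis
    unfolding inn_homogeneous[OF x(2)] inn_homogeneous[OF y(2)] inn_homogeneous[OF hom]
      act_scale_right[OF finite_supp_act[OF x(1) a]] act_scale_right[OF finite_supp_act[OF y(1) a]]
      act_brk[OF x y a]
    by (cases P; cases qx; cases qy) simp_all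
qed

section \<open>Derivations\<close>

locale index_group =
  fixes \<Gamma> :: "real set" and s :: real
  assumes zero_mem: "0 \<in> \<Gamma>"
    and add_mem: "x \<in> \<Gamma> \<Longrightarrow> y \<in> \<Gamma> \<Longrightarrow> x + y \<in> \<Gamma>"
    and minus_mem: "x \<in> \<Gamma> \<Longrightarrow> - x \<in> \<Gamma>"
    and nontrivial: "\<Gamma> \<noteq> {0}"
    and double_s_mem: "2 * s \<in> \<Gamma>"
begin

lemma of_int_mult_mem:
  assumes "x \<in> \<Gamma>"
  shows "of_int n * x \<in> \<Gamma>"
proof (induction n rule: int_induct[of _ 0])
  case base
  show ?case
    by (simp add: zero_mem)
next
  case (step1 n)
  then show ?case
    using add_mem[OF _ assms] by (simp add: distrib_right)
next
  case (step2 n)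
  then show ?case
    using add_mem[OF _ minus_mem[OF assms]] by (simp add: left_diff_distrib)
qed

lemma pos_memE:
  obtains g where "g \<in> \<Gamma>" "g > 0"
proof -
  obtain x where "x \<in> \<Gamma>" "x \<noteq> 0"
    using zero_mem nontrivial by blast
  with that[of x] that[of "- x"] minus_mem show ?thesis
    by (cases "x > 0") auto
qed

lemma valid_shift_iff:
  assumes "p \<in> \<Gamma>"
  shows "valid \<Gamma> s (shift p b) \<longleftrightarrow> valid \<Gamma> s b"
proof -
  have "x + p \<in> \<Gamma> \<longleftrightarrow> x \<in> \<Gamma>" for x
    using add_mem[OF _ assms, of x] add_mem[OF _ minus_mem[OF assms], of "x + p"] by auto
  from this[of "grade b"] this[of "grade b - s"] show ?thesis
    by (cases b) (simp_all add: diff_add_eq)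
qed

text \<open>Only the instances \<open>[L p, e]\<close> of the derivation rule are required; they already force \<open>D\<close> to
  be inner.\<close>
definition L_derivation :: "bool \<Rightarrow> (B \<Rightarrow> B \<times> B \<Rightarrow> complex) \<Rightarrow> bool" where
  "L_derivation P D \<longleftrightarrow> (\<forall>e. valid \<Gamma> s e \<longrightarrow> finite (supp (D e))) \<and>
     (\<forall>p\<in>\<Gamma>. \<forall>e k. valid \<Gamma> s e \<longrightarrow> of_real (density e * p - grade e) * D (shift p e) k
        = ad_tensor (L p) (D e) k - sg (par e \<and> P) * ad_tensor e (D (L p)) k)"

lemma L_derivationD:
  assumes "L_derivation P D" "valid \<Gamma> s e"
  shows "finite (supp (D e))"
    "p \<in> \<Gamma> \<Longrightarrow> of_real (density e * p - grade e) * D (shift p e) k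
      = ad_tensor (L p) (D e) k - sg (par e \<and> P) * ad_tensor e (D (L p)) k"
  using assms unfolding L_derivation_def by blast+

lemma L_derivation_inner_on_basis:
  assumes "finite (supp a)"
  shows "L_derivation P (inner_on_basis P a)"
  unfolding L_derivation_def
proof (intro conjI allI ballI impI)
  fix e
  show "finite (supp (inner_on_basis P a e))"
    by (rule finite_subset[OF _ finite_supp_ad_tensor[OF assms, of e]])
      (auto simp: supp_def inner_on_basis_def)
next
  fix p e k
  have "ad_tensor (L p) (ad_tensor e a) k - ad_tensor e (ad_tensor (L p) a) k
      = of_real (density e * p - grade e) * ad_tensor (shift p e) a k"
    using ad_tensor_br[of "L p" e a k] unfolding br_L sum_supp_vec by simp
  moreover have "inner_on_basis P a e = (\<lambda>k. sg (par e \<and> P) * ad_tensor e a k)"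
    "inner_on_basis P a (L p) = ad_tensor (L p) a"
    by (auto simp: inner_on_basis_def conj_commute)
  ultimately show "of_real (density e * p - grade e) * inner_on_basis P a (shift p e) k
      = ad_tensor (L p) (inner_on_basis P a e) k
      - sg (par e \<and> P) * ad_tensor e (inner_on_basis P a (L p)) k"
    by (simp only: ad_tensor_scale)
      (simp add: inner_on_basis_def conj_commute right_diff_distrib[symmetric])
qed

lemma L_derivation_diff:
  assumes "L_derivation P D" "L_derivation P D'"
  shows "L_derivation P (\<lambda>e k. D e k - D' e k)"
  unfolding L_derivation_def
proof (intro conjI allI ballI impI)
  fix e
  assume "valid \<Gamma> s e"
  then show "finite (supp (\<lambda>k. D e k - D' e k))"
    by (intro finite_subset[OF _ finite_UnI[OF assms[THEN L_derivationD(1)]]])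
      (auto simp: supp_def)
next
  fix p e k
  assume "p \<in> \<Gamma>" "valid \<Gamma> s e"
  with assms[THEN L_derivationD(2)]
  show "of_real (density e * p - grade e) * (D (shift p e) k - D' (shift p e) k)
      = ad_tensor (L p) (\<lambda>k. D e k - D' e k) k
      - sg (par e \<and> P) * ad_tensor e (\<lambda>k. D (L p) k - D' (L p) k) k"
    unfolding ad_tensor_diff right_diff_distrib by simp
qed

lemma L_derivation_witt_cocycle:
  assumes D: "L_derivation P D" and "g \<in> \<Gamma>"
  shows "witt_cocycle g (\<lambda>n. D (L (of_int n * g)))"
  unfolding witt_cocycle_def
proof (intro allI)
  fix m n k
  have "valid \<Gamma> s (L (of_int n * g))" "of_int m * g \<in> \<Gamma>"
    using of_int_mult_mem[OF \<open>g \<in> \<Gamma>\<close>] by simp_all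
  from L_derivationD(2)[OF D this, of k]
  show "of_real (of_int (m - n) * g) * D (L (of_int (m + n) * g)) k
      = ad_tensor (L (of_int m * g)) (D (L (of_int n * g))) k
      - ad_tensor (L (of_int n * g)) (D (L (of_int m * g))) k"
    by (simp add: algebra_simps)
qed

lemma L_derivation_at_kernel:
  assumes "L_derivation P D" "p \<in> \<Gamma>" "valid \<Gamma> s e" and "D (L p) = (\<lambda>_. 0)"
  shows "of_real (density e * p - grade e) * D (shift p e) k = ad_tensor (L p) (D e) k"
  using L_derivationD(2)[OF assms(1,3,2), of k] unfolding assms(4) ad_tensor_zero by simp

lemma L_derivation_two_paths:
  assumes D: "L_derivation P D" and p: "p \<in> \<Gamma>" and e: "valid \<Gamma> s e"
    and kernel: "D (L p) = (\<lambda>_. 0)" "D (L (2 * p)) = (\<lambda>_. 0)" "D (L (3 * p)) = (\<lambda>_. 0)"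
  shows "of_real (density e * (3 * p) - grade e) * ad_tensor (L (2 * p)) (ad_tensor (L p) (D e)) k
    = of_real (density e * p - grade e) * of_real (density e * (2 * p) - (grade e + p)) *
      ad_tensor (L (3 * p)) (D e) k"
proof -
  have multiples: "2 * p \<in> \<Gamma>" "3 * p \<in> \<Gamma>"
    using of_int_mult_mem[OF p, of 2] of_int_mult_mem[OF p, of 3] by simp_all
  have shift_e: "valid \<Gamma> s (shift p e)"
    using e p by (simp add: valid_shift_iff)
  have "ad_tensor (L p) (D e) = (\<lambda>k. of_real (density e * p - grade e) * D (shift p e) k)"
    using L_derivation_at_kernel[OF D p e kernel(1)] by (simp add: fun_eq_iff)
  then have "ad_tensor (L (2 * p)) (ad_tensor (L p) (D e)) k
      = of_real (density e * p - grade e) * ad_tensor (L (2 * p)) (D (shift p e)) k"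
    by (simp only: ad_tensor_scale)
  also have "ad_tensor (L (2 * p)) (D (shift p e)) k
      = of_real (density e * (2 * p) - (grade e + p)) * D (shift (3 * p) e) k"
    using L_derivation_at_kernel[OF D multiples(1) shift_e kernel(2), of k] by simp
  finally show ?thesis
    using L_derivation_at_kernel[OF D multiples(2) e kernel(3), of k] by simp
qed

lemma L_derivation_eq_0_if_0_on_multiples:
  assumes D: "L_derivation P D" and "g \<in> \<Gamma>" "g > 0"
    and zero: "\<And>n. D (L (of_int n * g)) = (\<lambda>_. 0)" and e: "valid \<Gamma> s e"
  shows "D e (b, c) = 0"
proof (rule ccontr)
  assume nonzero: "D e (b, c) \<noteq> 0"
  obtain C where "C \<ge> 0"
    and C: "\<forall>b c. D e (b, c) \<noteq> 0 \<longrightarrow> \<bar>grade b\<bar> \<le> C \<and> \<bar>grade c\<bar> \<le> C"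
    using finite_supp_grade_bounded[OF L_derivationD(1)[OF D e]] by blast
  obtain n where n: "2 * C + \<bar>grade e\<bar> < of_int n * g"
    using eventually_of_int_mult_gt[OF \<open>g > 0\<close>] unfolding eventually_at_top_linorder by blast
  define p where "p = of_int n * g"
  have p: "2 * C + \<bar>grade e\<bar> < p" "2 * C < p" "p > 0"
    using n \<open>C \<ge> 0\<close> by (auto simp: p_def)
  have "p \<in> \<Gamma>"
    unfolding p_def using \<open>g \<in> \<Gamma>\<close> by (rule of_int_mult_mem)
  moreover have "D (L p) = (\<lambda>_. 0)" "D (L (2 * p)) = (\<lambda>_. 0)" "D (L (3 * p)) = (\<lambda>_. 0)"
    using zero[of n] zero[of "2 * n"] zero[of "3 * n"] by (simp_all add: p_def mult.assoc)
  ultimately have "of_real (density e * (3 * p) - grade e) *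
      (of_real (density b * (2 * p) - grade b) * of_real (density c * p - grade c) *
      D e (b, c)) = 0"
    using L_derivation_two_paths[OF D _ e, of p "(shift (2 * p) b, shift p c)"]
    unfolding ad_tensor_L_separates[where v = "D e", OF C p(2,3) nonzero] by simp
  then have "density e * (3 * p) - grade e = 0 \<or> density b * (2 * p) - grade b = 0
      \<or> density c * p - grade c = 0"
    using nonzero by (simp only: mult_eq_0_iff of_real_eq_0_iff) blast
  moreover have "density e * (3 * p) \<ge> 3 / 2 * p" "density b * (2 * p) \<ge> p"
    "density c * p \<ge> p / 2"
    using density_ge_half[of e] density_ge_half[of b] density_ge_half[of c] p(3)
    by (simp_all add: field_simps)
  moreover have "\<bar>grade b\<bar> \<le> C" "\<bar>grade c\<bar> \<le> C"
    using C nonzero by blast+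
  ultimately show False
    using p \<open>C \<ge> 0\<close> by argo
qed

definition tensor_valid :: "B \<times> B \<Rightarrow> bool" where
  "tensor_valid k \<longleftrightarrow> valid \<Gamma> s (fst k) \<and> valid \<Gamma> s (snd k)"

lemma homV_iff:
  "homV \<Gamma> s P v \<longleftrightarrow> finite (supp v) \<and> (\<forall>k\<in>supp v. tensor_valid k \<and> tensor_par k = P)"
  unfolding homV_def Vcar_def tensor_valid_def tensor_par_def by blast

definition hom_part :: "bool \<Rightarrow> (B \<times> B \<Rightarrow> complex) \<Rightarrow> B \<times> B \<Rightarrow> complex" where
  "hom_part P v k = (if tensor_valid k \<and> tensor_par k = P then v k else 0)"

lemma homV_hom_part:
  assumes "finite (supp v)"
  shows "homV \<Gamma> s P (hom_part P v)"
  unfolding homV_iff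
proof
  show "finite (supp (hom_part P v))"
    by (rule finite_subset[OF _ assms]) (auto simp: supp_def hom_part_def)
qed (auto simp: supp_def hom_part_def)

lemma hom_part_eq_self: "homV \<Gamma> s P v \<Longrightarrow> hom_part P v = v"
  unfolding homV_iff hom_part_def by (fastforce simp: fun_eq_iff supp_def)

lemma ad_tensor_L_hom_part:
  assumes "p \<in> \<Gamma>"
  shows "ad_tensor (L p) (hom_part P v) = hom_part P (ad_tensor (L p) v)"
proof
  fix k :: "B \<times> B"
  obtain b c where "k = (b, c)"
    by (cases k)
  then show "ad_tensor (L p) (hom_part P v) k = hom_part P (ad_tensor (L p) v) k"
    using valid_shift_iff[OF minus_mem[OF assms]]
    by (simp add: ad_tensor_L hom_part_def tensor_valid_def tensor_par_def)
qed

theorem L_derivation_imp_inner: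
  assumes D: "L_derivation P D" and hom: "\<And>p. p \<in> \<Gamma> \<Longrightarrow> homV \<Gamma> s P (D (L p))"
  shows "\<exists>a. homV \<Gamma> s P a \<and> (\<forall>e. valid \<Gamma> s e \<longrightarrow> D e = inner_on_basis P a e)"
proof -
  obtain g where g: "g \<in> \<Gamma>" "g > 0"
    by (rule pos_memE)
  have mem: "of_int n * g \<in> \<Gamma>" for n
    using g(1) by (rule of_int_mult_mem)
  have "finite (supp (D (L (of_int n * g))))" for n
    using L_derivationD(1)[OF D] mem by simp
  then obtain v where v: "finite (supp v)"
    "\<forall>n. D (L (of_int n * g)) = ad_tensor (L (of_int n * g)) v"
    using witt_cocycle_is_coboundary[OF L_derivation_witt_cocycle[OF D g(1)] g(2)] by blast
  define a where "a = hom_part P v"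
  have a: "homV \<Gamma> s P a"
    unfolding a_def using v(1) by (rule homV_hom_part)
  have "D (L (of_int n * g)) = ad_tensor (L (of_int n * g)) a" for n
    using hom_part_eq_self[OF hom[OF mem]] v(2) unfolding a_def ad_tensor_L_hom_part[OF mem]
    by simp
  then have "(\<lambda>k. D (L (of_int n * g)) k - inner_on_basis P a (L (of_int n * g)) k)
      = (\<lambda>_. 0)" for n
    by (simp add: inner_on_basis_def)
  moreover have "L_derivation P (\<lambda>e k. D e k - inner_on_basis P a e k)"
    using a unfolding homV_iff by (intro L_derivation_diff D L_derivation_inner_on_basis) blast
  ultimately have "D e (b, c) - inner_on_basis P a e (b, c) = 0" if "valid \<Gamma> s e" for e b c
    using L_derivation_eq_0_if_0_on_multiples[OF _ g _ that,
        where D = "\<lambda>e k. D e k - inner_on_basis P a e k"] by blast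
  then have "D e = inner_on_basis P a e" if "valid \<Gamma> s e" for e
    using that by (simp add: fun_eq_iff)
  with a show ?thesis
    by blast
qed

lemma br_valid:
  assumes "valid \<Gamma> s e" "valid \<Gamma> s f" "br e f g \<noteq> 0"
  shows "valid \<Gamma> s g"
proof -
  have even_odd: "p + r - s \<in> \<Gamma>" if "p \<in> \<Gamma>" "r - s \<in> \<Gamma>" for p r
    using add_mem[OF that] by (simp add: add_diff_eq)
  have odd_odd: "r + t \<in> \<Gamma>" if "r - s \<in> \<Gamma>" "t - s \<in> \<Gamma>" for r t
    using add_mem[OF add_mem[OF that] double_s_mem] by simp
  show ?thesis
    using assms add_mem even_odd odd_odd
    by (cases e; cases f) (auto simp: vec_def split: if_splits)
qed

lemma actb_valid:
  assumes "actb e t k \<noteq> 0" "valid \<Gamma> s e" "tensor_valid t"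
  shows "tensor_valid k"
  using actb_nonzero[OF assms(1)] assms(2,3) br_valid unfolding tensor_valid_def by metis

lemma vec_Lcar: "valid \<Gamma> s e \<Longrightarrow> vec e c \<in> Lcar \<Gamma> s"
  unfolding Lcar_def using supp_vec_subset[of e c] finite_supp_vec by auto

lemma homL_vec: "valid \<Gamma> s e \<Longrightarrow> homL \<Gamma> s (par e) (vec e c)"
  unfolding homL_def using vec_Lcar supp_vec_subset[of e c] by auto

lemma is_der_add:
  assumes "is_der \<Gamma> s P d" "x \<in> Lcar \<Gamma> s" "y \<in> Lcar \<Gamma> s"
  shows "d (\<lambda>b. x b + y b) = (\<lambda>k. d x k + d y k)"
  using assms unfolding is_der_def by blast

lemma is_der_scale:
  assumes "is_der \<Gamma> s P d" "x \<in> Lcar \<Gamma> s"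
  shows "d (\<lambda>b. c * x b) = (\<lambda>k. c * d x k)"
  using assms unfolding is_der_def by blast

lemma is_der_brk:
  assumes "is_der \<Gamma> s P d" "homL \<Gamma> s qx x" "homL \<Gamma> s qy y"
  shows "d (brk x y)
    = (\<lambda>k. sg (P \<and> qx) * act x (d y) k - sg (qy \<and> (P \<noteq> qx)) * act y (d x) k)"
  using assms unfolding is_der_def by blast

lemma is_der_vec:
  assumes "is_der \<Gamma> s P d" "valid \<Gamma> s e"
  shows "d (vec e c) k = c * d (vec e 1) k"
proof -
  have "vec e c = (\<lambda>b. c * vec e 1 b)"
    by (auto simp: vec_def)
  then show ?thesis
    using is_der_scale[OF assms(1) vec_Lcar[OF assms(2), of 1], of c] by simp
qed

lemma is_der_expand:
  assumes d: "is_der \<Gamma> s P d" and x: "x \<in> Lcar \<Gamma> s"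
  shows "d x k = (\<Sum>e\<in>supp x. x e * d (vec e 1) k)"
proof -
  have "d x k = (\<Sum>e\<in>A. x e * d (vec e 1) k)"
    if "finite A" "\<forall>b\<in>A. valid \<Gamma> s b" "supp x \<subseteq> A" for A x
    using that
  proof (induction A arbitrary: x rule: finite_induct)
    case empty
    then have "x = (\<lambda>b. 0 * x b)" "x \<in> Lcar \<Gamma> s"
      by (auto simp: supp_def Lcar_def)
    then have "d x k = 0"
      using is_der_scale[OF d, of x 0] by simp
    then show ?case
      by simp
  next
    case (insert e A)
    define y where "y = x(e := 0)"
    have supp_y: "supp y \<subseteq> A"
      using insert.prems(2) unfolding y_def supp_def by auto
    then have y: "y \<in> Lcar \<Gamma> s"
      using insert.hyps insert.prems unfolding Lcar_def by (auto intro: finite_subset)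
    have e: "valid \<Gamma> s e"
      using insert.prems by simp
    have "x = (\<lambda>b. y b + vec e (x e) b)"
      unfolding y_def vec_def by auto
    then have "d x k = d y k + x e * d (vec e 1) k"
      using is_der_add[OF d y vec_Lcar[OF e, of "x e"]] is_der_vec[OF d e, of "x e"] by simp
    also have "d y k = (\<Sum>e\<in>A. y e * d (vec e 1) k)"
      using insert.IH[OF _ supp_y] insert.prems by simp
    also have "\<dots> = (\<Sum>e\<in>A. x e * d (vec e 1) k)"
      by (rule sum.cong) (use insert.hyps in \<open>auto simp: y_def\<close>)
    finally show ?case
      using insert.hyps by (simp add: add.commute)
  qed
  with x show ?thesis
    unfolding Lcar_def by blast
qed

lemma is_der_L_derivation:
  assumes d: "is_der \<Gamma> s P d"
  shows "L_derivation P (\<lambda>e. d (vec e 1))"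
proof -
  have fin: "finite (supp (d (vec e 1)))" if "valid \<Gamma> s e" for e
    using d vec_Lcar[OF that] unfolding is_der_def Vcar_def by blast
  moreover have "of_real (density e * p - grade e) * d (vec (shift p e) 1) k
      = ad_tensor (L p) (d (vec e 1)) k - sg (par e \<and> P) * ad_tensor e (d (vec (L p) 1)) k"
    if p: "p \<in> \<Gamma>" and e: "valid \<Gamma> s e" for p e k
  proof -
    have Lp: "valid \<Gamma> s (L p)" and shift_e: "valid \<Gamma> s (shift p e)"
      using p e by (simp_all add: valid_shift_iff)
    have "of_real (density e * p - grade e) * d (vec (shift p e) 1) k
        = d (brk (vec (L p) 1) (vec e 1)) k"
      unfolding brk_vec br_L by (rule is_der_vec[OF d shift_e, symmetric])
    also have "\<dots> = sg (P \<and> par (L p)) * act (vec (L p) 1) (d (vec e 1)) k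
        - sg (par e \<and> (P \<noteq> par (L p))) * act (vec e 1) (d (vec (L p) 1)) k"
      by (simp only: is_der_brk[OF d homL_vec[OF Lp] homL_vec[OF e]])
    also have "\<dots> = ad_tensor (L p) (d (vec e 1)) k
        - sg (par e \<and> P) * ad_tensor e (d (vec (L p) 1)) k"
      by (simp add: act_vec fin Lp e del: valid.simps)
    finally show ?thesis .
  qed
  ultimately show ?thesis
    unfolding L_derivation_def by blast
qed

theorem is_der_imp_inn:
  assumes d: "is_der \<Gamma> s P d"
  shows "\<exists>a. homV \<Gamma> s P a \<and> (\<forall>x\<in>Lcar \<Gamma> s. d x = inn P a x)"
proof -
  have "homV \<Gamma> s P (d (vec (L p) 1))" if "p \<in> \<Gamma>" for p
    using d homL_vec[of "L p" 1] that unfolding is_der_def by fastforce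
  then obtain a where a: "homV \<Gamma> s P a"
    "\<forall>e. valid \<Gamma> s e \<longrightarrow> d (vec e 1) = inner_on_basis P a e"
    using L_derivation_imp_inner[OF is_der_L_derivation[OF d]] by blast
  have "d x k = inn P a x k" if "x \<in> Lcar \<Gamma> s" for x k
  proof -
    have x: "finite (supp x)" "\<forall>e\<in>supp x. valid \<Gamma> s e"
      using that unfolding Lcar_def by blast+
    have "d x k = (\<Sum>e\<in>supp x. x e * inner_on_basis P a e k)"
      unfolding is_der_expand[OF d that] using x(2) a(2) by simp
    also have "\<dots> = inn P a x k"
      using a(1) x(1) by (simp add: homV_iff inn_eq_sum)
    finally show ?thesis .
  qed
  with a(1) show ?thesis
    by blast
qed

lemma inn_Vcar:
  assumes a: "homV \<Gamma> s P a" and x: "x \<in> Lcar \<Gamma> s"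
  shows "inn P a x \<in> Vcar \<Gamma> s"
proof -
  have "tensor_valid k" if k: "k \<in> supp (inn P a x)" for k
  proof -
    obtain e t where "e \<in> supp x" "t \<in> supp a" "k \<in> supp (actb e t)"
      using k supp_inn_subset by blast
    then show ?thesis
      using a x actb_valid unfolding homV_iff Lcar_def supp_def by blast
  qed
  moreover have "finite (supp (inn P a x))"
    using a x unfolding homV_iff Lcar_def by (intro finite_supp_inn) auto
  ultimately show ?thesis
    unfolding Vcar_def tensor_valid_def by blast
qed

lemma homV_inn:
  assumes a: "homV \<Gamma> s P a" and x: "homL \<Gamma> s q x"
  shows "homV \<Gamma> s (q \<noteq> P) (inn P a x)"
proof -
  have "tensor_par k = (q \<noteq> P)" if k: "k \<in> supp (inn P a x)" for k
  proof -
    obtain e t where "e \<in> supp x" "t \<in> supp a" "k \<in> supp (actb e t)"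
      using k supp_inn_subset by blast
    moreover from this have "tensor_par k = (par e \<noteq> tensor_par t)"
      by (intro actb_par) (simp add: supp_def)
    ultimately show ?thesis
      using a x unfolding homV_iff homL_def by blast
  qed
  moreover have "inn P a x \<in> Vcar \<Gamma> s"
    using inn_Vcar[OF a] x unfolding homL_def by blast
  ultimately show ?thesis
    unfolding homV_iff Vcar_def tensor_valid_def by blast
qed

theorem is_der_inn:
  assumes a: "homV \<Gamma> s P a"
  shows "is_der \<Gamma> s P (inn P a)"
  unfolding is_der_def
proof (intro conjI ballI allI impI ext)
  have fin_a: "finite (supp a)"
    using a unfolding homV_iff by blast
  show "inn P a (\<lambda>b. x b + y b) k = inn P a x k + inn P a y k"
    if "x \<in> Lcar \<Gamma> s" "y \<in> Lcar \<Gamma> s" for x y k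
    using that fin_a unfolding Lcar_def by (intro inn_add) auto
  show "inn P a (\<lambda>b. c * x b) k = c * inn P a x k" if "x \<in> Lcar \<Gamma> s" for c x k
    using that fin_a unfolding Lcar_def by (intro inn_scale) auto
  show "inn P a (brk x y) k
      = sg (P \<and> qx) * act x (inn P a y) k - sg (qy \<and> (P \<noteq> qx)) * act y (inn P a x) k"
    if "homL \<Gamma> s qx x" "homL \<Gamma> s qy y" for qx qy x y k
    using that fin_a unfolding homL_def Lcar_def by (intro inn_brk) auto
  show "inn P a x \<in> Vcar \<Gamma> s" if "x \<in> Lcar \<Gamma> s" for x
    using a that by (rule inn_Vcar)
  show "homV \<Gamma> s (q \<noteq> P) (inn P a x)" if "homL \<Gamma> s q x" for q x
    using a that by (rule homV_inn)
qed

end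

theorem mainTheorem1:
  fixes \<Gamma> :: "real set" and s :: real
  assumes "0 \<in> \<Gamma>"
    and "\<forall>x\<in>\<Gamma>. \<forall>y\<in>\<Gamma>. x + y \<in> \<Gamma>"
    and "\<forall>x\<in>\<Gamma>. - x \<in> \<Gamma>"
    and "\<Gamma> \<noteq> {0}"
    and "2 * s \<in> \<Gamma>"
  shows "\<forall>d. Der \<Gamma> s d \<longleftrightarrow> Inn \<Gamma> s d"
proof (intro allI iffI)
  interpret index_group \<Gamma> s
    using assms by unfold_locales auto
  fix d
  show "Inn \<Gamma> s d" if der: "Der \<Gamma> s d"
  proof -
    obtain d0 d1 where "is_der \<Gamma> s False d0" "is_der \<Gamma> s True d1"
      and d: "\<forall>x\<in>Lcar \<Gamma> s. d x = (\<lambda>k. d0 x k + d1 x k)"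
      using der unfolding Der_def by blast
    then obtain a0 a1 where "homV \<Gamma> s False a0" "\<forall>x\<in>Lcar \<Gamma> s. d0 x = inn False a0 x"
      "homV \<Gamma> s True a1" "\<forall>x\<in>Lcar \<Gamma> s. d1 x = inn True a1 x"
      using is_der_imp_inn by meson
    with d show ?thesis
      unfolding Inn_def by (intro exI[of _ a0] exI[of _ a1]) simp
  qed
  show "Der \<Gamma> s d" if "Inn \<Gamma> s d"
    using that is_der_inn unfolding Der_def Inn_def by blast
qed

end
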